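(* Let $\mathcal{G}=(V,\mathcal{E})$ be a hypergraph, let $h,k,\alpha,\beta\in\mathbb{Z}_{>0}$, and let $\ell,\ell':\{1,\dots,k\}\to\mathbb{Z}_{>0}$ be such that $$\sum_{i=1}^k\ell'(i)\ \ge\ \beta\ \ge\ \alpha\ \ge\ \sum_{i=1}^k\ell(i),\qquad |V|\ge \ell'(i)\ge \ell(i)\ \text{ for every } 1\le i\le k.$$ There exists an $h$-regular $(\ell,\ell')$-bordered $(\alpha,\beta)$-limited packing of $k$ rooted hyperforests in $\mathcal{G}$ if and only if all of the following hold: $$h|V|\ge\alpha,$$ $$\beta-\sum_{i=1}^k\ell(i)+\sum_{i=1}^k\min\{\ell(i),|\mathcal{P}|\}+e_{\mathcal{E}}(\mathcal{P})\ \ge\ h|\mathcal{P}|\quad\text{for every partition }\mathcal{P}\text{ of }V,$$ $$\sum_{i=1}^k\min\{\ell'(i),|\mathcal{P}|\}+e_{\mathcal{E}}(\mathcal{P})\ \ge\ h|\mathcal{P}|\quad\text{for every partition }\mathcal{P}\text{ of }V.$$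
   Context: All structures are finite with nonempty vertex set; parallel hyperedges are allowed. A hypergraph $\mathcal{G}=(V,\mathcal{E})$ has vertex set $V$ and a (multi)set $\mathcal{E}$ of hyperedges, each consisting of at least two vertices of $V$. For a partition $\mathcal{P}$ of $V$, $e_{\mathcal{E}}(\mathcal{P})$ is the number of hyperedges in $\mathcal{E}$ that enter some member of $\mathcal{P}$, i.e. that intersect at least two members of $\mathcal{P}$. A dypergraph (directed hypergraph) has hyperarcs, each with exactly one head and at least one tail. Orienting a hyperedge $X$ means choosing one vertex of $X$ to be its head, the other vertices of $X$ becoming its tails. Trimming a hyperarc means replacing it by an arc $yx$ where $x$ is its head and $y$ is one of its tails. A digraph $(U,F)$ is a branching with root set $S$ (an $S$-branching) if $S\subseteq U$ and there is a unique path from $S$ to every $u\in U$; that is, it is a vertex-disjoint union of $|S|$ arborescences, each having exactly one vertex of $S$, which is its root. For a dypergraph $\mathcal{B}$, $V_{\ge1}(\mathcal{B})$ is the set of vertices of in-degree at least $1$ in $\mathcal{B}$ (heads of hyperarcs of $\mathcal{B}$). A dypergraph $\mathcal{B}=(U,\mathcal{F})$ is an $S$-hyperbranching if $S\subseteq U$ and the hyperarcs in $\mathcal{F}$ can be trimmed to an arc set $F$ such that $(V_{\ge1}(\mathcal{B})\cup S,F)$ is an $S$-branching; its core is $V_{\ge1}(\mathcal{B})\cup S$. A hypergraph is a (rooted) hyperforest with root set $S$ (an $S$-hyperforest) if its hyperedges can be oriented to obtain an $S$-hyperbranching. A packing of $k$ rooted hyperforests in $\mathcal{G}$ is a collection $\mathcal{T}_1,\dots,\mathcal{T}_k$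 of pairwise hyperedge-disjoint subhypergraphs of $\mathcal{G}$, where $\mathcal{T}_i$ is an $S_i$-hyperforest. It is $h$-regular if the $\mathcal{T}_i$ can be oriented to $S_i$-hyperbranchings such that every vertex of $V$ belongs to exactly $h$ of their cores; $(\ell,\ell')$-bordered if $\ell(i)\le|S_i|\le\ell'(i)$ for every $1\le i\le k$; and $(\alpha,\beta)$-limited if $\alpha\le\sum_{i=1}^k|S_i|\le\beta$. *)

theory Defs
  imports Main "HOL-Library.Disjoint_Sets" "Graph_Theory.Arc_Walk"
begin

text \<open>Hyperedges and hyperarcs carry identifiers, so that parallel ones are allowed.\<close>

record ('a, 'e) hypergraph =
  hverts :: "'a set"
  hedges :: "'e set"
  hends :: "'e \<Rightarrow> 'a set"

definition is_hypergraph :: "('a, 'e) hypergraph \<Rightarrow> bool" where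
  "is_hypergraph G \<longleftrightarrow> finite (hverts G) \<and> hverts G \<noteq> {} \<and> finite (hedges G) \<and>
     (\<forall>e\<in>hedges G. hends G e \<subseteq> hverts G \<and> 2 \<le> card (hends G e))"

definition subhypergraph :: "('a, 'e) hypergraph \<Rightarrow> ('a, 'e) hypergraph \<Rightarrow> bool" where
  "subhypergraph H G \<longleftrightarrow> is_hypergraph H \<and> hverts H \<subseteq> hverts G \<and> hedges H \<subseteq> hedges G \<and>
     (\<forall>e\<in>hedges H. hends H e = hends G e)"

definition entering_hyperedges :: "('a, 'e) hypergraph \<Rightarrow> 'a set set \<Rightarrow> nat" where
  "entering_hyperedges G P = card {e \<in> hedges G. 2 \<le> card {X \<in> P. hends G e \<inter> X \<noteq> {}}}"

record ('a, 'e) dypergraph =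
  dverts :: "'a set"
  harcs :: "'e set"
  dtails :: "'e \<Rightarrow> 'a set"
  dhead :: "'e \<Rightarrow> 'a"

definition is_dypergraph :: "('a, 'e) dypergraph \<Rightarrow> bool" where
  "is_dypergraph B \<longleftrightarrow> finite (dverts B) \<and> dverts B \<noteq> {} \<and> finite (harcs B) \<and>
     (\<forall>a\<in>harcs B. dhead B a \<in> dverts B \<and> dtails B a \<subseteq> dverts B \<and>
        dtails B a \<noteq> {} \<and> dhead B a \<notin> dtails B a)"

text \<open>An orientation of a hypergraph is given by the function selecting the heads.\<close>

definition is_orientation :: "('a, 'e) hypergraph \<Rightarrow> ('e \<Rightarrow> 'a) \<Rightarrow> bool" where
  "is_orientation G r \<longleftrightarrow> (\<forall>e\<in>hedges G. r e \<in> hends G e)"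

definition orient :: "('a, 'e) hypergraph \<Rightarrow> ('e \<Rightarrow> 'a) \<Rightarrow> ('a, 'e) dypergraph" where
  "orient G r = \<lparr>dverts = hverts G, harcs = hedges G,
     dtails = (\<lambda>e. hends G e - {r e}), dhead = r\<rparr>"

text \<open>
  The paths are simple. Uniqueness of simple paths from \<open>S\<close> alone would still permit an arc
  that closes a circuit, for instance one returning to a root from a vertex reached from it.
  A disjoint union of arborescences rooted at the vertices of \<open>S\<close> has no circuit, and
  excluding circuits is exactly what is missing: together with the uniqueness of paths it forces
  in-degree 0 at the vertices of \<open>S\<close> and in-degree 1 at all others.
\<close>

definition is_branching :: "('a, 'e) pre_digraph \<Rightarrow> 'a set \<Rightarrow> bool" where
  "is_branching D S \<longleftrightarrow> wf_digraph D \<and> S \<subseteq> verts D \<and>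
     (\<forall>u\<in>verts D. \<exists>!(s, p). s \<in> S \<and> pre_digraph.apath D s p u) \<and>
     (\<nexists>p. pre_digraph.cycle D p)"

definition hin_degree :: "('a, 'e) dypergraph \<Rightarrow> 'a \<Rightarrow> nat" where
  "hin_degree B v = card {a \<in> harcs B. dhead B a = v}"

definition core :: "('a, 'e) dypergraph \<Rightarrow> 'a set \<Rightarrow> 'a set" where
  "core B S = {v \<in> dverts B. 1 \<le> hin_degree B v} \<union> S"

definition is_trimming :: "('a, 'e) dypergraph \<Rightarrow> ('e \<Rightarrow> 'a) \<Rightarrow> bool" where
  "is_trimming B t \<longleftrightarrow> (\<forall>a\<in>harcs B. t a \<in> dtails B a)"

definition is_hyperbranching :: "('a, 'e) dypergraph \<Rightarrow> 'a set \<Rightarrow> bool" where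
  "is_hyperbranching B S \<longleftrightarrow> is_dypergraph B \<and> S \<subseteq> dverts B \<and>
     (\<exists>t. is_trimming B t \<and>
        is_branching \<lparr>verts = core B S, arcs = harcs B, tail = t, head = dhead B\<rparr> S)"

definition is_hyperforest :: "('a, 'e) hypergraph \<Rightarrow> 'a set \<Rightarrow> bool" where
  "is_hyperforest T S \<longleftrightarrow> is_hypergraph T \<and>
     (\<exists>r. is_orientation T r \<and> is_hyperbranching (orient T r) S)"

definition hyperforest_packing ::
    "('a, 'e) hypergraph \<Rightarrow> nat \<Rightarrow> (nat \<Rightarrow> ('a, 'e) hypergraph) \<Rightarrow> (nat \<Rightarrow> 'a set) \<Rightarrow> bool" where
  "hyperforest_packing G k T S \<longleftrightarrow>
     (\<forall>i\<in>{1..k}. subhypergraph (T i) G \<and> is_hyperforest (T i) (S i)) \<and>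
     (\<forall>i\<in>{1..k}. \<forall>j\<in>{1..k}. i \<noteq> j \<longrightarrow> hedges (T i) \<inter> hedges (T j) = {})"

definition regular_packing ::
    "('a, 'e) hypergraph \<Rightarrow> nat \<Rightarrow> nat \<Rightarrow> (nat \<Rightarrow> ('a, 'e) hypergraph) \<Rightarrow> (nat \<Rightarrow> 'a set) \<Rightarrow> bool" where
  "regular_packing G h k T S \<longleftrightarrow>
     (\<exists>r. (\<forall>i\<in>{1..k}. is_orientation (T i) (r i) \<and> is_hyperbranching (orient (T i) (r i)) (S i)) \<and>
          (\<forall>v\<in>hverts G. card {i \<in> {1..k}. v \<in> core (orient (T i) (r i)) (S i)} = h))"

definition bordered_packing ::
    "nat \<Rightarrow> (nat \<Rightarrow> nat) \<Rightarrow> (nat \<Rightarrow> nat) \<Rightarrow> (nat \<Rightarrow> 'a set) \<Rightarrow> bool" where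
  "bordered_packing k l l' S \<longleftrightarrow> (\<forall>i\<in>{1..k}. l i \<le> card (S i) \<and> card (S i) \<le> l' i)"

definition limited_packing :: "nat \<Rightarrow> nat \<Rightarrow> nat \<Rightarrow> (nat \<Rightarrow> 'a set) \<Rightarrow> bool" where
  "limited_packing k \<alpha> \<beta> S \<longleftrightarrow> \<alpha> \<le> (\<Sum>i=1..k. card (S i)) \<and> (\<Sum>i=1..k. card (S i)) \<le> \<beta>"

end

theory Submission
  imports Defs
begin

text \<open>
  For the necessity of the two partition conditions, choose a vertex in every member of a
  partition. It lies in \<open>h\<close> cores, and a core reaching into a member \<open>X\<close> either has a root in
  \<open>X\<close> or uses a hyperarc entering \<open>X\<close>. Such a hyperarc is charged only to the member that contains
  its head, so \<open>h |P| \<le> \<Sum>i. min |S i| |P| + e P\<close> (\<open>packing_partition_bound\<close>). The two conditions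
  follow from this by replacing the sizes \<open>|S i|\<close> by their bounds. The remaining condition counts
  the roots in the cores.

  For the converse, the numbers \<open>m i\<close> of roots are fixed first. Among all choices within the
  borders that have a given sum \<open>M\<close>, the most balanced one makes \<open>\<Sum>i. min (m i) p\<close> as large as
  possible for every \<open>p\<close> at once. At each \<open>p\<close> this value reaches the bound that comes from \<open>l'\<close> or the one
  that comes from \<open>M\<close> and \<open>l\<close> (\<open>balanced_sizes_exist\<close>). With \<open>M = min \<beta> (h |V|)\<close> this leaves
  the condition \<open>h |P| \<le> \<Sum>i. min (m i) |P| + e P\<close> for exact sizes.

  The places of the roots and the hyperedges to be used are then chosen simultaneously. Call
  a pair \<open>(i, v)\<close> a token: it makes \<open>v\<close> a root of the \<open>i\<close>-th hyperforest. Wanted are \<open>m i\<close> tokens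
  of each colour \<open>i\<close> and \<open>h |V| - \<Sum>i. m i\<close> hyperedges, such that every vertex set \<open>X\<close> contains
  at most \<open>h |X| - h + min h c\<close> of the chosen objects, where \<open>c\<close> is the number of colours present
  in \<open>X\<close>. The constant term \<open>- h\<close> makes this bound negative for the empty set, so it can only be
  used as a submodular function on intersecting sets. But its lower truncation is submodular throughout (\<open>truncation_submodular\<close>), so a theorem of Rado's type
  (\<open>rado_transversal\<close>) yields the choice. Its hypothesis involves the minimum of a sum over
  partitions of the ground set. Such a sum does not grow when classes with overlapping supports
  are merged, and what remains are partitions of \<open>V\<close> (\<open>demand_partition_bound\<close>).

  Finally, Hall's theorem orients the chosen hyperedges so that a vertex holding \<open>z\<close> tokens gets
  in-degree \<open>h - z\<close>. Sparsity then says exactly that the colours in \<open>X\<close> and the hyperarcs entering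
  \<open>X\<close> together number at least \<open>h\<close>, for every nonempty \<open>X\<close>. Under this condition the root sets can be
  enlarged one vertex at a time, as in Lovasz's proof of Edmonds' branching theorem, until
  every vertex has \<open>h\<close> colours (\<open>regular_packing_exists\<close>).
\<close>

section \<open>Partitions of finite sets\<close>

lemma sum_partition_on:
  assumes P: "partition_on F P" and F: "finite F"
  shows "sum x F = (\<Sum>U\<in>P. sum x U)"
proof -
  have "\<And>U. U \<in> P \<Longrightarrow> finite U"
    using partition_onD1[OF P] F by (meson Sup_upper finite_subset)
  moreover have "\<forall>U\<in>P. \<forall>U'\<in>P. U \<noteq> U' \<longrightarrow> U \<inter> U' = {}"
    using partition_onD2[OF P] by (simp add: disjoint_def)
  ultimately have "sum x (\<Union>P) = (\<Sum>U\<in>P. sum x U)"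
    by (subst sum.Union_disjoint) auto
  then show ?thesis using partition_onD1[OF P] by simp
qed

lemma card_partition_le:
  assumes P: "partition_on V P" and V: "finite V"
  shows "card P \<le> card V"
proof -
  have "card P = (\<Sum>X\<in>P. 1)" by simp
  also have "\<dots> \<le> (\<Sum>X\<in>P. card X)"
  proof (rule sum_mono)
    fix X assume "X \<in> P"
    then have "X \<subseteq> V" "X \<noteq> {}" using partition_onD1[OF P] partition_onD3[OF P] by blast+
    then show "1 \<le> card X" using V finite_subset by (simp add: Suc_le_eq card_gt_0_iff)
  qed
  also have "\<dots> = card V" using sum_partition_on[OF P V, of "\<lambda>_. 1 :: nat"] by simp
  finally show ?thesis .
qed

text \<open>
  This is the induction step for bounding a partition sum from below: as long as two classes can be
  merged at no cost, the number of classes drops.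
\<close>

lemma partition_on_merge:
  assumes P: "partition_on W \<U>" and fin: "finite \<U>" and U: "U \<in> \<U>" "U' \<in> \<U>" "U \<noteq> U'"
    and le: "\<phi> (U \<union> U') \<le> \<phi> U + (\<phi> U' :: int)"
  defines "\<U>' \<equiv> insert (U \<union> U') (\<U> - {U, U'})"
  shows "partition_on W \<U>'" "card \<U>' < card \<U>" "sum \<phi> \<U>' \<le> sum \<phi> \<U>"
proof -
  have disj: "X = Y" if "X \<in> \<U>" "Y \<in> \<U>" "X \<inter> Y \<noteq> {}" for X Y
    using partition_onD2[OF P] that by (auto simp: disjoint_def)
  have ne: "X \<noteq> {}" if "X \<in> \<U>" for X using partition_onD3[OF P] that by blast
  have new: "U \<union> U' \<notin> \<U> - {U, U'}"
  proof
    assume "U \<union> U' \<in> \<U> - {U, U'}"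
    then have "U = U \<union> U'" using disj[OF U(1)] ne[OF U(1)] by blast
    then show False using \<open>U \<union> U' \<in> \<U> - {U, U'}\<close> by blast
  qed
  show "partition_on W \<U>'"
  proof (rule partition_onI)
    show "\<Union>\<U>' = W" using partition_onD1[OF P] U by (auto simp: \<U>'_def)
    show "{} \<notin> \<U>'" using ne U by (auto simp: \<U>'_def)
    fix X Y assume XY: "X \<in> \<U>'" "Y \<in> \<U>'" "X \<noteq> Y"
    show "disjnt X Y"
    proof (rule ccontr)
      assume "\<not> disjnt X Y"
      then obtain x where x: "x \<in> X" "x \<in> Y" by (auto simp: disjnt_def)
      have unique: "Z = Z'" if "Z \<in> \<U>" "Z' \<in> \<U>" "x \<in> Z" "x \<in> Z'" for Z Z'
        using disj that by blast
      consider "X \<in> \<U> - {U, U'}" "Y \<in> \<U> - {U, U'}" | "X = U \<union> U'" "Y \<in> \<U> - {U, U'}"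
        | "Y = U \<union> U'" "X \<in> \<U> - {U, U'}" using XY by (auto simp: \<U>'_def)
      then show False
      proof cases
        case 1
        then show False using unique[of X Y] x XY by simp
      next
        case 2
        then show False using unique[of U Y] unique[of U' Y] x U by auto
      next
        case 3
        then show False using unique[of U X] unique[of U' X] x U by auto
      qed
    qed
  qed
  have c: "card {U, U'} = 2" using U(3) by simp
  have "card {U, U'} \<le> card \<U>" using U fin by (intro card_mono) auto
  moreover have "card (\<U> - {U, U'}) = card \<U> - card {U, U'}" using U fin by (intro card_Diff_subset) auto
  ultimately show "card \<U>' < card \<U>" using new fin c by (simp add: \<U>'_def)
  have "sum \<phi> \<U> = sum \<phi> (\<U> - {U, U'}) + sum \<phi> {U, U'}"
    using U fin by (intro sum.subset_diff) auto
  moreover have "sum \<phi> \<U>' = \<phi> (U \<union> U') + sum \<phi> (\<U> - {U, U'})"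
    unfolding \<U>'_def using new fin by (intro sum.insert) auto
  ultimately show "sum \<phi> \<U>' \<le> sum \<phi> \<U>" using le U(3) by simp
qed

text \<open>
  A vertex of \<open>S\<close> lies in only one member of the partition.
\<close>

lemma card_members_meeting_le:
  assumes P: "partition_on V P" and V: "finite V" and S: "finite S"
  shows "card {X \<in> P. S \<inter> X \<noteq> {}} \<le> min (card S) (card P)"
proof -
  have finP: "finite P" using finite_elements[OF V P] .
  define g where "g X = (SOME s. s \<in> S \<inter> X)" for X
  have g: "g X \<in> S \<inter> X" if "S \<inter> X \<noteq> {}" for X
    unfolding g_def using that by (metis some_in_eq)
  have "inj_on g {X \<in> P. S \<inter> X \<noteq> {}}"
  proof (rule inj_onI)
    fix X Y assume "X \<in> {X \<in> P. S \<inter> X \<noteq> {}}" "Y \<in> {X \<in> P. S \<inter> X \<noteq> {}}" "g X = g Y"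
    then have "X \<in> P" "Y \<in> P" "X \<inter> Y \<noteq> {}" using g[of X] g[of Y] by auto
    then show "X = Y" using partition_onD2[OF P] by (auto simp: disjoint_def)
  qed
  then have "card {X \<in> P. S \<inter> X \<noteq> {}} \<le> card S"
    using g S by (intro card_inj_on_le[of g]) auto
  moreover have "card {X \<in> P. S \<inter> X \<noteq> {}} \<le> card P"
    using finP by (intro card_mono) auto
  ultimately show ?thesis by simp
qed

text \<open>
  A hyperedge that meets a single member lies inside it, because the members cover \<open>V\<close>. Inclusion in
  a member is the form that matters below: it passes to larger members and restricts to smaller hyperedges.
\<close>

lemma hyperedge_within_iff:
  assumes P: "partition_on V P" and V: "finite V" and e: "e \<subseteq> V" "e \<noteq> {}"
  shows "2 \<le> card {X \<in> P. e \<inter> X \<noteq> {}} \<longleftrightarrow> \<not> (\<exists>X\<in>P. e \<subseteq> X)"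
proof -
  let ?M = "{X \<in> P. e \<inter> X \<noteq> {}}"
  have finM: "finite ?M" using finite_elements[OF V P] by simp
  have cover: "e \<subseteq> \<Union>?M" using e partition_onD1[OF P] by blast
  have disj: "X = Y" if "X \<in> P" "Y \<in> P" "X \<inter> Y \<noteq> {}" for X Y
    using partition_onD2[OF P] that by (auto simp: disjoint_def)
  show ?thesis
  proof
    assume two: "2 \<le> card ?M"
    show "\<not> (\<exists>X\<in>P. e \<subseteq> X)"
    proof
      assume "\<exists>X\<in>P. e \<subseteq> X"
      then obtain X where X: "X \<in> P" "e \<subseteq> X" by blast
      have "?M \<subseteq> {X}" using disj X by blast
      then have "card ?M \<le> card {X}" by (intro card_mono) auto
      then show False using two by simp
    qed
  next
    assume no: "\<not> (\<exists>X\<in>P. e \<subseteq> X)"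
    show "2 \<le> card ?M"
    proof (rule ccontr)
      assume "\<not> 2 \<le> card ?M"
      then have "card ?M \<le> Suc 0" by simp
      then have one: "\<forall>X\<in>?M. \<forall>Y\<in>?M. X = Y" using card_le_Suc0_iff_eq[OF finM] by simp
      obtain X where X: "X \<in> ?M" using cover e by blast
      then have "e \<subseteq> X" using cover one by blast
      then show False using no X by blast
    qed
  qed
qed

lemma entering_hyperedges_conv:
  assumes G: "is_hypergraph G" and P: "partition_on (hverts G) P"
  shows "entering_hyperedges G P = card {e \<in> hedges G. \<not> (\<exists>X\<in>P. hends G e \<subseteq> X)}"
proof -
  have "2 \<le> card {X \<in> P. hends G e \<inter> X \<noteq> {}} \<longleftrightarrow> \<not> (\<exists>X\<in>P. hends G e \<subseteq> X)"
    if "e \<in> hedges G" for e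
  proof -
    have "hends G e \<subseteq> hverts G" "2 \<le> card (hends G e)" "finite (hverts G)"
      using G that by (simp_all add: is_hypergraph_def)
    moreover from this have "hends G e \<noteq> {}" by force
    ultimately show ?thesis using hyperedge_within_iff[OF P] by blast
  qed
  then show ?thesis
    unfolding entering_hyperedges_def by (intro arg_cong[where f = card]) blast
qed

section \<open>Lower truncation of an intersecting submodular function\<close>

text \<open>
  The submodular inequality is required only for intersecting sets. Bounds with a constant term
  \<open>- h\<close> are of this kind: at the empty set they would be negative, and with the value 0
  there the inequality fails for disjoint sets.
\<close>

locale intersecting_submodular =
  fixes W :: "'b set" and f :: "'b set \<Rightarrow> int"
  assumes finite_ground: "finite W"
    and submodular: "\<lbrakk>A \<subseteq> W; B \<subseteq> W; A \<inter> B \<noteq> {}\<rbrakk> \<Longrightarrow> f (A \<union> B) + f (A \<inter> B) \<le> f A + f B"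
    and mono: "\<lbrakk>A \<noteq> {}; A \<subseteq> B; B \<subseteq> W\<rbrakk> \<Longrightarrow> f A \<le> f B"
    and nonneg: "\<lbrakk>A \<noteq> {}; A \<subseteq> W\<rbrakk> \<Longrightarrow> 0 \<le> f A"
begin

definition truncation :: "'b set \<Rightarrow> int" where
  "truncation F = Min ((\<lambda>P. \<Sum>U\<in>P. f U) ` {P. partition_on F P})"

definition feasible :: "('b \<Rightarrow> int) \<Rightarrow> 'b set \<Rightarrow> bool" where
  "feasible x F \<longleftrightarrow> (\<forall>T\<subseteq>F. T \<noteq> {} \<longrightarrow> sum x T \<le> f T)"

text \<open>
  A saturated vector is an optimal solution of the linear program that is dual to the minimum over
  partitions: the greedy algorithm produces it, and it witnesses the value of the truncation.
\<close>

definition saturated :: "('b \<Rightarrow> int) \<Rightarrow> 'b set \<Rightarrow> bool" where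
  "saturated x F \<longleftrightarrow> feasible x F \<and> (\<forall>a\<in>F. \<exists>T\<subseteq>F. a \<in> T \<and> sum x T = f T)"

lemma finite_subset_ground: "F \<subseteq> W \<Longrightarrow> finite F"
  using finite_ground finite_subset by blast

lemma truncation_le:
  assumes "F \<subseteq> W" "partition_on F P"
  shows "truncation F \<le> (\<Sum>U\<in>P. f U)"
  unfolding truncation_def
  using assms finitely_many_partition_on[OF finite_subset_ground[OF assms(1)]]
  by (intro Min_le) auto

lemma truncation_attained:
  assumes "F \<subseteq> W"
  obtains P where "partition_on F P" "truncation F = (\<Sum>U\<in>P. f U)"
proof -
  have "truncation F \<in> (\<lambda>P. \<Sum>U\<in>P. f U) ` {P. partition_on F P}"
    unfolding truncation_def
  proof (intro Min_in)
    show "finite ((\<lambda>P. \<Sum>U\<in>P. f U) ` {P. partition_on F P})"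
      using finitely_many_partition_on[OF finite_subset_ground[OF assms]] by auto
    show "(\<lambda>P. \<Sum>U\<in>P. f U) ` {P. partition_on F P} \<noteq> {}"
      using partition_on_singletons[of F] by blast
  qed
  then show ?thesis using that by blast
qed

lemma truncation_le_self: "F \<subseteq> W \<Longrightarrow> F \<noteq> {} \<Longrightarrow> truncation F \<le> f F"
  using truncation_le[OF _ partition_on_space[of F]] by simp

lemma truncation_empty: "truncation {} = 0"
proof -
  obtain P where "partition_on {} P" "truncation {} = (\<Sum>U\<in>P. f U)"
    using truncation_attained[OF empty_subsetI] .
  then show ?thesis by (simp add: partition_on_empty)
qed

text \<open>
  The usual uncrossing: both sides of the submodular inequality agree with the modular function \<open>x\<close>
  at the given sets, so feasibility forces equality at the union.
\<close>

lemma tight_Un: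
  assumes x: "feasible x F" and F: "F \<subseteq> W" and T: "T \<subseteq> F" "sum x T = f T"
    and T': "T' \<subseteq> F" "sum x T' = f T'" and ne: "T \<inter> T' \<noteq> {}"
  shows "sum x (T \<union> T') = f (T \<union> T')"
proof -
  have fin: "finite T" "finite T'" using T T' F finite_subset_ground by blast+
  have "sum x (T \<union> T') + sum x (T \<inter> T') = sum x T + sum x T'"
    using fin by (rule sum.union_inter)
  moreover have "f (T \<union> T') + f (T \<inter> T') \<le> f T + f T'"
    using T T' F ne by (intro submodular) auto
  moreover have "T \<union> T' \<subseteq> F" "T \<union> T' \<noteq> {}" "T \<inter> T' \<subseteq> F" using T T' ne by auto
  then have "sum x (T \<union> T') \<le> f (T \<union> T')" "sum x (T \<inter> T') \<le> f (T \<inter> T')"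
    using x ne unfolding feasible_def by blast+
  ultimately show ?thesis using T T' by linarith
qed

lemma feasible_le_truncation:
  assumes x: "feasible x F" and F: "F \<subseteq> W"
  shows "sum x F \<le> truncation F"
proof -
  obtain P where P: "partition_on F P" "truncation F = (\<Sum>U\<in>P. f U)"
    using truncation_attained[OF F] .
  have "sum x F = sum (sum x) P"
    using sum_partition_on[OF P(1) finite_subset_ground[OF F]] .
  also have "\<dots> \<le> (\<Sum>U\<in>P. f U)"
    using x P(1) by (intro sum_mono) (auto simp: feasible_def partition_on_def)
  finally show ?thesis using P by simp
qed

text \<open>
  Tight sets that meet have a tight union, so the maximal tight sets are pairwise disjoint. Since
  they cover \<open>F\<close>, they form a partition whose sum attains the minimum.
\<close>

lemma saturated_sum:
  assumes x: "saturated x F" and F: "F \<subseteq> W"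
  shows "sum x F = truncation F"
proof (rule antisym)
  have fx: "feasible x F" using x by (simp add: saturated_def)
  show "sum x F \<le> truncation F" using feasible_le_truncation[OF fx F] .
  have finF: "finite F" using finite_subset_ground[OF F] .
  define tight where "tight = {T. T \<subseteq> F \<and> T \<noteq> {} \<and> sum x T = f T}"
  define P where "P = {T \<in> tight. \<forall>T'\<in>tight. T \<subseteq> T' \<longrightarrow> T = T'}"
  have fint: "finite tight" unfolding tight_def using finF by simp
  have part: "partition_on F P"
  proof (rule partition_onI)
    show "\<Union>P = F"
    proof
      show "\<Union>P \<subseteq> F" unfolding P_def tight_def by auto
      show "F \<subseteq> \<Union>P"
      proof
        fix a assume "a \<in> F"
        then obtain T where T: "T \<in> tight" "a \<in> T"
          using x unfolding saturated_def tight_def by blast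
        then obtain M where "M \<in> tight" "T \<subseteq> M" "\<forall>T'\<in>tight. M \<subseteq> T' \<longrightarrow> M = T'"
          using finite_has_maximal2[OF fint T(1)] by blast
        then show "a \<in> \<Union>P" using T unfolding P_def by blast
      qed
    qed
    show "{} \<notin> P" unfolding P_def tight_def by auto
    fix T T' assume TT: "T \<in> P" "T' \<in> P" "T \<noteq> T'"
    show "disjnt T T'"
    proof (rule ccontr)
      assume "\<not> disjnt T T'"
      then have un: "T \<union> T' \<in> tight"
        using TT tight_Un[OF fx F, of T T'] unfolding P_def tight_def disjnt_def by auto
      have maximal: "T = M" if "T \<in> P" "M \<in> tight" "T \<subseteq> M" for T M
        using that unfolding P_def by simp
      have "T = T \<union> T'" "T' = T \<union> T'"
        by (rule maximal[OF TT(1) un Un_upper1], rule maximal[OF TT(2) un Un_upper2])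
      then show False using TT(3) by simp
    qed
  qed
  have "truncation F \<le> (\<Sum>U\<in>P. f U)" by (rule truncation_le[OF F part])
  also have "\<dots> = sum (sum x) P" by (intro sum.cong) (auto simp: P_def tight_def)
  also have "\<dots> = sum x F" by (rule sum_partition_on[OF part finF, symmetric])
  finally show "truncation F \<le> sum x F" .
qed

text \<open>
  The greedy step: the new coordinate is raised until some set through \<open>a\<close> becomes tight, while the
  old coordinates, and hence the old tight sets, stay as they are.
\<close>

lemma saturated_insert:
  assumes x: "saturated x F" and F: "insert a F \<subseteq> W" and a: "a \<notin> F"
  shows "\<exists>y. saturated y (insert a F) \<and> (\<forall>b\<in>F. y b = x b)"
proof -
  have finF: "finite F" using finite_subset_ground F by simp
  define Z where "Z = (\<lambda>T. f (insert a T) - sum x T) ` Pow F"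
  have Z: "finite Z" "Z \<noteq> {}" unfolding Z_def using finF by auto
  define y where "y = x(a := Min Z)"
  have yF: "sum y T = sum x T" if "T \<subseteq> F" for T
    using that a unfolding y_def by (intro sum.cong) auto
  have ya: "sum y (insert a T) = Min Z + sum x T" if "T \<subseteq> F" for T
  proof -
    have "sum y (insert a T) = y a + sum y T"
      using that a finF finite_subset by (intro sum.insert) auto
    then show ?thesis using yF[OF that] by (simp add: y_def)
  qed
  have feas: "feasible y (insert a F)"
    unfolding feasible_def
  proof (intro allI impI)
    fix T assume T: "T \<subseteq> insert a F" "T \<noteq> {}"
    show "sum y T \<le> f T"
    proof (cases "a \<in> T")
      case False
      then have "T \<subseteq> F" using T by auto
      moreover from this have "sum x T \<le> f T"
        using x T(2) unfolding saturated_def feasible_def by simp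
      ultimately show ?thesis using yF by simp
    next
      case True
      then have "T = insert a (T - {a})" "T - {a} \<subseteq> F" using T by auto
      moreover from this have "Min Z \<le> f T - sum x (T - {a})"
        using Z(1) unfolding Z_def by (intro Min_le image_eqI[of _ _ "T - {a}"]) auto
      ultimately show ?thesis using ya[of "T - {a}"] by simp
    qed
  qed
  have "\<exists>T\<subseteq>insert a F. b \<in> T \<and> sum y T = f T" if "b \<in> insert a F" for b
  proof (cases "b = a")
    case True
    obtain T where "T \<subseteq> F" "Min Z = f (insert a T) - sum x T"
      using Min_in[OF Z] unfolding Z_def by auto
    then show ?thesis using ya[of T] True by (intro exI[of _ "insert a T"]) auto
  next
    case False
    then obtain T where "T \<subseteq> F" "b \<in> T" "sum x T = f T"
      using x \<open>b \<in> insert a F\<close> unfolding saturated_def by blast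
    then show ?thesis using yF by (intro exI[of _ T]) auto
  qed
  then show ?thesis using feas a by (intro exI[of _ y]) (auto simp: saturated_def y_def)
qed

lemma saturated_extend:
  assumes x: "saturated x F" and G: "G \<subseteq> W" and FG: "F \<subseteq> G"
  shows "\<exists>y. saturated y G \<and> (\<forall>b\<in>F. y b = x b)"
proof -
  have "finite (G - F)" using finite_subset_ground[OF G] by simp
  moreover have "\<exists>y. saturated y (F \<union> D) \<and> (\<forall>b\<in>F. y b = x b)" if "finite D" "D \<subseteq> G - F" for D
    using that
  proof (induction D)
    case empty
    then show ?case using x by auto
  next
    case (insert a D)
    then obtain y where y: "saturated y (F \<union> D)" "\<forall>b\<in>F. y b = x b" by auto
    have "insert a (F \<union> D) \<subseteq> W" "a \<notin> F \<union> D" using insert G FG by auto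
    from saturated_insert[OF y(1) this]
    obtain z where "saturated z (insert a (F \<union> D))" "\<forall>b\<in>F \<union> D. z b = y b" by blast
    then show ?case using y by (intro exI[of _ z]) auto
  qed
  ultimately obtain y where "saturated y (F \<union> (G - F))" "\<forall>b\<in>F. y b = x b" by blast
  then show ?thesis using FG by (metis Un_Diff_cancel sup.absorb2)
qed

lemma saturated_exists: "F \<subseteq> W \<Longrightarrow> \<exists>x. saturated x F"
proof -
  assume F: "F \<subseteq> W"
  have "saturated (\<lambda>_. 0) {}" by (simp add: saturated_def feasible_def)
  from saturated_extend[OF this F empty_subsetI] show ?thesis by blast
qed

text \<open>
  If \<open>x b\<close> were negative, removing \<open>b\<close> from a tight set would leave a set whose sum exceeds its bound,
  because \<open>f\<close> is monotone.
\<close>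

lemma saturated_nonneg:
  assumes x: "saturated x F" and F: "F \<subseteq> W" and b: "b \<in> F"
  shows "0 \<le> x b"
proof -
  obtain T where T: "T \<subseteq> F" "b \<in> T" "sum x T = f T"
    using x b unfolding saturated_def by blast
  have finT: "finite T" using T F finite_subset_ground by blast
  have split: "f T = x b + sum x (T - {b})"
    using T finT by (metis sum.remove)
  show ?thesis
  proof (cases "T = {b}")
    case True
    then show ?thesis using split nonneg[of T] T F by auto
  next
    case False
    then have ne: "T - {b} \<noteq> {}" using T by auto
    have "sum x (T - {b}) \<le> f (T - {b})"
      using x T ne unfolding saturated_def feasible_def by (meson Diff_subset order_trans)
    also have "\<dots> \<le> f T" using T F ne by (intro mono) auto
    finally show ?thesis using split by simp
  qed
qed

lemma truncation_mono:
  assumes "F \<subseteq> G" "G \<subseteq> W"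
  shows "truncation F \<le> truncation G"
proof -
  obtain x where x: "saturated x F" using saturated_exists assms by blast
  obtain y where y: "saturated y G" "\<forall>b\<in>F. y b = x b"
    using saturated_extend[OF x assms(2,1)] by blast
  have "truncation F = sum y F" using saturated_sum[OF x] y(2) assms by simp
  also have "\<dots> \<le> sum y G"
    using saturated_nonneg[OF y(1) assms(2)] assms finite_subset_ground
    by (intro sum_mono2) auto
  finally show ?thesis using saturated_sum[OF y(1) assms(2)] by simp
qed

text \<open>
  Extend a saturated vector on \<open>F \<inter> G\<close> to one on \<open>F \<union> G\<close>. The extension attains the truncation
  at both of these sets, and it is feasible, hence a lower bound, at \<open>F\<close> and \<open>G\<close>. Since it is
  modular, the inequality follows.
\<close>

lemma truncation_submodular:
  assumes F: "F \<subseteq> W" and G: "G \<subseteq> W"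
  shows "truncation (F \<union> G) + truncation (F \<inter> G) \<le> truncation F + truncation G"
proof -
  have sub: "F \<inter> G \<subseteq> W" "F \<union> G \<subseteq> W" "F \<inter> G \<subseteq> F \<union> G" using F G by auto
  obtain x where x: "saturated x (F \<inter> G)" using saturated_exists[OF sub(1)] by blast
  obtain y where y: "saturated y (F \<union> G)" "\<forall>b\<in>F \<inter> G. y b = x b"
    using saturated_extend[OF x sub(2,3)] by blast
  have "truncation (F \<union> G) = sum y (F \<union> G)" using saturated_sum[OF y(1) sub(2)] by simp
  moreover have "truncation (F \<inter> G) = sum y (F \<inter> G)"
    using saturated_sum[OF x sub(1)] y(2) by (metis sum.cong)
  moreover have "sum y (F \<union> G) + sum y (F \<inter> G) = sum y F + sum y G"
    using assms finite_subset_ground by (intro sum.union_inter) auto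
  moreover have "feasible y F" "feasible y G"
    using y(1) unfolding saturated_def feasible_def by (simp_all add: le_supI1 le_supI2)
  ultimately show ?thesis
    using feasible_le_truncation[of y F] feasible_le_truncation[of y G] assms by linarith
qed

end

section \<open>Independent transversals\<close>

text \<open>
  Rado's theorem with an arbitrary monotone submodular \<open>\<rho>\<close> in place of a matroid rank. As long as some
  set has two elements \<open>x\<close> and \<open>y\<close>, one of them can be removed: otherwise two index sets \<open>K\<close> and
  \<open>L\<close> witness the failure of both removals, and uncrossing them contradicts the condition for
  \<open>K \<union> L\<close> or for \<open>K \<inter> L\<close> without the index at hand.
\<close>

lemma rado_transversal:
  fixes \<rho> :: "'b set \<Rightarrow> int" and A :: "'j \<Rightarrow> 'b set"
  assumes "finite J" and "finite W" and "\<And>j. j \<in> J \<Longrightarrow> A j \<subseteq> W"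
    and empty: "\<rho> {} \<le> 0"
    and mono: "\<And>F G. F \<subseteq> G \<Longrightarrow> G \<subseteq> W \<Longrightarrow> \<rho> F \<le> \<rho> G"
    and submod: "\<And>F G. F \<subseteq> W \<Longrightarrow> G \<subseteq> W \<Longrightarrow> \<rho> (F \<union> G) + \<rho> (F \<inter> G) \<le> \<rho> F + \<rho> G"
    and "\<And>K. K \<subseteq> J \<Longrightarrow> int (card K) \<le> \<rho> (\<Union>j\<in>K. A j)"
  shows "\<exists>a. (\<forall>j\<in>J. a j \<in> A j) \<and> (\<forall>K\<subseteq>J. int (card K) \<le> \<rho> (a ` K))"
  using assms(3,7)
proof (induction "\<Sum>j\<in>J. card (A j)" arbitrary: A rule: less_induct)
  case less
  note A = less.prems(1) and hall = less.prems(2)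
  have finA: "finite (A j)" if "j \<in> J" for j using A[OF that] \<open>finite W\<close> finite_subset by blast
  have neA: "A j \<noteq> {}" if "j \<in> J" for j
    using hall[of "{j}"] empty that by auto
  show ?case
  proof (cases "\<forall>j\<in>J. \<exists>b. A j = {b}")
    case True
    then obtain a where a: "\<forall>j\<in>J. A j = {a j}" by metis
    have "(\<Union>j\<in>K. A j) = a ` K" if "K \<subseteq> J" for K using a that by auto
    then show ?thesis using a hall by (intro exI[of _ a]) auto
  next
    case False
    then obtain i where i: "i \<in> J" "\<not> (\<exists>b. A i = {b})" by blast
    obtain x where x: "x \<in> A i" using neA[OF i(1)] by blast
    then obtain y where xy: "x \<in> A i" "y \<in> A i" "x \<noteq> y" using i(2) by blast
    define B where "B z = A(i := A i - {z})" for z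
    have smaller: "(\<Sum>j\<in>J. card (B z j)) < (\<Sum>j\<in>J. card (A j))" if "z \<in> A i" for z
    proof (rule sum_strict_mono_ex1[OF \<open>finite J\<close>])
      show "\<forall>j\<in>J. card (B z j) \<le> card (A j)" using finA i(1) by (auto simp: B_def intro: card_mono)
      show "\<exists>j\<in>J. card (B z j) < card (A j)"
        using i(1) card_Diff1_less[OF finA[OF i(1)] that]
        by (intro bexI[of _ i]) (simp_all add: B_def del: card_Diff_insert card_Diff_singleton)
    qed
    have BW: "B z j \<subseteq> W" if "j \<in> J" for z j using A[OF that] by (auto simp: B_def)
    have BA: "B z j \<subseteq> A j" for z j by (auto simp: B_def)
    have "(\<forall>K\<subseteq>J. int (card K) \<le> \<rho> (\<Union>j\<in>K. B x j)) \<or> (\<forall>K\<subseteq>J. int (card K) \<le> \<rho> (\<Union>j\<in>K. B y j))"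
    proof (rule ccontr)
      assume "\<not> ?thesis"
      then have "\<exists>K. K \<subseteq> J \<and> \<rho> (\<Union>j\<in>K. B x j) < int (card K)"
        "\<exists>L. L \<subseteq> J \<and> \<rho> (\<Union>j\<in>L. B y j) < int (card L)"
        unfolding not_le[symmetric] by metis+
      then obtain K L where K: "K \<subseteq> J" "\<rho> (\<Union>j\<in>K. B x j) < int (card K)"
        and L: "L \<subseteq> J" "\<rho> (\<Union>j\<in>L. B y j) < int (card L)" by metis
      have same: "(\<Union>j\<in>M. B z j) = (\<Union>j\<in>M. A j)" if "i \<notin> M" for M z
        using that unfolding B_def by auto
      have iK: "i \<in> K" using hall[OF K(1)] K(2) same[of K x] by (cases "i \<in> K") simp_all
      have iL: "i \<in> L" using hall[OF L(1)] L(2) same[of L y] by (cases "i \<in> L") simp_all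
      note iKL = iK iL
      have fin: "finite K" "finite L" using K L \<open>finite J\<close> finite_subset by auto
      let ?F = "\<Union>j\<in>K. B x j" and ?G = "\<Union>j\<in>L. B y j"
      have un: "?F \<union> ?G = (\<Union>j\<in>K \<union> L. A j)"
      proof
        show "?F \<union> ?G \<subseteq> (\<Union>j\<in>K \<union> L. A j)" using BA by blast
        have "A j \<subseteq> ?F \<union> ?G" if "j \<in> K \<union> L" for j
        proof (cases "j = i")
          case True
          have "A i \<subseteq> B x i \<union> B y i" using xy by (auto simp: B_def)
          then show ?thesis using iKL True by blast
        next
          case False
          then have "B x j = A j" "B y j = A j" by (auto simp: B_def)
          then show ?thesis using that by blast
        qed
        then show "(\<Union>j\<in>K \<union> L. A j) \<subseteq> ?F \<union> ?G" by blast
      qed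
      have int: "(\<Union>j\<in>(K \<inter> L) - {i}. A j) \<subseteq> ?F \<inter> ?G"
      proof
        fix b assume "b \<in> (\<Union>j\<in>(K \<inter> L) - {i}. A j)"
        then obtain j where "j \<in> K" "j \<in> L" "j \<noteq> i" "b \<in> A j" by auto
        then have "b \<in> B x j" "b \<in> B y j" by (auto simp: B_def)
        then show "b \<in> ?F \<inter> ?G" using \<open>j \<in> K\<close> \<open>j \<in> L\<close> by blast
      qed
      have FW: "?F \<subseteq> W" "?G \<subseteq> W" using BW K L by blast+
      have "int (card (K \<union> L)) \<le> \<rho> (?F \<union> ?G)"
        unfolding un using K L by (intro hall) auto
      moreover have "int (card ((K \<inter> L) - {i})) \<le> \<rho> (?F \<inter> ?G)"
      proof -
        have "int (card ((K \<inter> L) - {i})) \<le> \<rho> (\<Union>j\<in>(K \<inter> L) - {i}. A j)"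
          using K by (intro hall) auto
        also have "\<dots> \<le> \<rho> (?F \<inter> ?G)" using FW by (intro mono[OF int]) auto
        finally show ?thesis .
      qed
      moreover have "card (K \<union> L) + card (K \<inter> L) = card K + card L"
        using card_Un_Int[OF fin] by simp
      moreover have "card (K \<inter> L) = Suc (card ((K \<inter> L) - {i}))"
        using iKL fin card_Suc_Diff1[of "K \<inter> L" i] by simp
      moreover have "\<rho> (?F \<union> ?G) + \<rho> (?F \<inter> ?G) \<le> \<rho> ?F + \<rho> ?G" using FW by (rule submod)
      ultimately show False using K L by linarith
    qed
    then obtain z where z: "z \<in> A i" "\<And>K. K \<subseteq> J \<Longrightarrow> int (card K) \<le> \<rho> (\<Union>j\<in>K. B z j)"
      using xy by blast
    obtain a where "\<forall>j\<in>J. a j \<in> B z j" "\<forall>K\<subseteq>J. int (card K) \<le> \<rho> (a ` K)"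
      using less.hyps[OF smaller[OF z(1)] BW z(2)] by blast
    then show ?thesis using BA by (intro exI[of _ a]) blast
  qed
qed

text \<open>
  Hall's theorem is the case of cardinality: \<open>card J \<le> card (a ` J)\<close> makes \<open>a\<close> injective.
\<close>

lemma hall_marriage:
  assumes "finite J" and "\<And>j. j \<in> J \<Longrightarrow> finite (A j)"
    and "\<And>K. K \<subseteq> J \<Longrightarrow> card K \<le> card (\<Union>j\<in>K. A j)"
  shows "\<exists>a. (\<forall>j\<in>J. a j \<in> A j) \<and> inj_on a J"
proof -
  have W: "finite (\<Union>j\<in>J. A j)" using assms by auto
  have "\<exists>a. (\<forall>j\<in>J. a j \<in> A j) \<and> (\<forall>K\<subseteq>J. int (card K) \<le> int (card (a ` K)))"
  proof (rule rado_transversal[where W = "\<Union>j\<in>J. A j" and \<rho> = "\<lambda>F. int (card F)"])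
    show "int (card (F \<union> G)) + int (card (F \<inter> G)) \<le> int (card F) + int (card G)"
      if "F \<subseteq> (\<Union>j\<in>J. A j)" "G \<subseteq> (\<Union>j\<in>J. A j)" for F G
      using card_Un_Int[of F G] that W finite_subset by (metis of_nat_add order_refl)
    show "int (card F) \<le> int (card G)" if "F \<subseteq> G" "G \<subseteq> (\<Union>j\<in>J. A j)" for F G
      using that W by (meson card_mono finite_subset of_nat_mono)
  qed (use assms W in auto)
  then obtain a where "\<forall>j\<in>J. a j \<in> A j" "card J \<le> card (a ` J)" by auto
  then show ?thesis using \<open>finite J\<close> card_image_le[of J a] by (metis eq_card_imp_inj_on le_antisym)
qed

section \<open>Choosing roots and hyperedges\<close>

text \<open>
  Elements of the ground set are tokens \<open>Inl (i, v)\<close>, which stand for the decision that \<open>v\<close> is a root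
  of the \<open>i\<close>-th hyperforest, and hyperedges \<open>Inr e\<close>.
\<close>

locale root_tokens =
  fixes V :: "'a set" and E :: "'e set" and ends :: "'e \<Rightarrow> 'a set" and h k :: nat
  assumes finite_V: "finite V" and finite_E: "finite E" and h_pos: "0 < h"
    and ends_sub: "e \<in> E \<Longrightarrow> ends e \<subseteq> V" and ends_two: "e \<in> E \<Longrightarrow> 2 \<le> card (ends e)"
begin

definition ground :: "((nat \<times> 'a) + 'e) set" where
  "ground = Inl ` ({1..k} \<times> V) \<union> Inr ` E"

definition support :: "((nat \<times> 'a) + 'e) set \<Rightarrow> 'a set" where
  "support U = {v. \<exists>i. Inl (i, v) \<in> U} \<union> (\<Union>e\<in>{e. Inr e \<in> U}. ends e)"

definition token_colours :: "((nat \<times> 'a) + 'e) set \<Rightarrow> nat set" where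
  "token_colours U = {i. \<exists>v. Inl (i, v) \<in> U}"

definition sparsity :: "((nat \<times> 'a) + 'e) set \<Rightarrow> int" where
  "sparsity U = int h * int (card (support U)) - int h + int (min h (card (token_colours U)))"

text \<open>
  A single hyperedge has sparsity \<open>h * (card (ends e) - 1)\<close>, which can exceed 1. Lowering the value at
  singletons to 1 prevents a hyperedge from representing two indices. This keeps
  submodularity on intersecting sets, because a singleton that meets a set is contained in it.
\<close>

definition demand :: "((nat \<times> 'a) + 'e) set \<Rightarrow> int" where
  "demand U = (if card U = 1 then 1 else sparsity U)"

lemma finite_ground: "finite ground"
  using finite_V finite_E by (simp add: ground_def)

lemma support_sub: "U \<subseteq> ground \<Longrightarrow> support U \<subseteq> V"
  using ends_sub by (fastforce simp: support_def ground_def)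

lemma finite_support: "U \<subseteq> ground \<Longrightarrow> finite (support U)"
  using support_sub finite_V finite_subset by blast

lemma finite_token_colours: "U \<subseteq> ground \<Longrightarrow> finite (token_colours U)"
  by (rule finite_subset[of _ "{1..k}"]) (auto simp: token_colours_def ground_def)

lemma support_mono: "U \<subseteq> U' \<Longrightarrow> support U \<subseteq> support U'"
  by (auto simp: support_def)

lemma token_colours_mono: "U \<subseteq> U' \<Longrightarrow> token_colours U \<subseteq> token_colours U'"
  by (auto simp: token_colours_def)

lemma support_Un: "support (U \<union> U') = support U \<union> support U'"
  by (auto simp: support_def)

lemma token_colours_Un: "token_colours (U \<union> U') = token_colours U \<union> token_colours U'"
  by (auto simp: token_colours_def)

lemma ends_ne: "e \<in> E \<Longrightarrow> ends e \<noteq> {}"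
  using ends_two by force

lemma support_nonempty:
  assumes "U \<subseteq> ground" "U \<noteq> {}"
  shows "support U \<noteq> {}"
proof -
  obtain x where x: "x \<in> U" "x \<in> ground" using assms by blast
  show ?thesis
  proof (cases x)
    case (Inl p)
    then obtain i v where "x = Inl (i, v)" by (cases p) simp
    then show ?thesis using x(1) unfolding support_def by blast
  next
    case (Inr e)
    then have "e \<in> E" using x(2) by (auto simp: ground_def)
    then obtain v where "v \<in> ends e" using ends_ne by blast
    then show ?thesis using x(1) Inr unfolding support_def by blast
  qed
qed

lemma card_support_pos: "U \<subseteq> ground \<Longrightarrow> U \<noteq> {} \<Longrightarrow> 1 \<le> card (support U)"
  using support_nonempty finite_support by (simp add: Suc_le_eq card_gt_0_iff)

lemma sparsity_mono:
  assumes "U \<subseteq> U'" "U' \<subseteq> ground"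
  shows "sparsity U \<le> sparsity U'"
proof -
  have "card (support U) \<le> card (support U')" "card (token_colours U) \<le> card (token_colours U')"
    using card_mono[OF finite_support[OF assms(2)] support_mono[OF assms(1)]]
      card_mono[OF finite_token_colours[OF assms(2)] token_colours_mono[OF assms(1)]] .
  then have "int h * int (card (support U)) \<le> int h * int (card (support U'))"
    "min h (card (token_colours U)) \<le> min h (card (token_colours U'))"
    by (auto intro: mult_left_mono)
  then show ?thesis unfolding sparsity_def by linarith
qed

lemma sparsity_submodular:
  assumes "U \<subseteq> ground" "U' \<subseteq> ground"
  shows "sparsity (U \<union> U') + sparsity (U \<inter> U') \<le> sparsity U + sparsity U'"
proof -
  have fs: "finite (support U)" "finite (support U')" and ft: "finite (token_colours U)" "finite (token_colours U')"
    using assms finite_support finite_token_colours by auto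
  have "support (U \<inter> U') \<subseteq> support U \<inter> support U'" "token_colours (U \<inter> U') \<subseteq> token_colours U \<inter> token_colours U'"
    by (auto simp: support_def token_colours_def)
  then have le: "card (support (U \<inter> U')) \<le> card (support U \<inter> support U')"
    "card (token_colours (U \<inter> U')) \<le> card (token_colours U \<inter> token_colours U')"
    using fs ft by (auto intro!: card_mono)
  have tok_le: "card (token_colours U \<inter> token_colours U') \<le> card (token_colours U)"
    "card (token_colours U \<inter> token_colours U') \<le> card (token_colours U')"
    using ft by (auto intro!: card_mono)
  have "card (support (U \<union> U')) + card (support (U \<inter> U')) \<le> card (support U) + card (support U')"
    unfolding support_Un using card_Un_Int[OF fs] le(1) by linarith
  then have "int h * (int (card (support (U \<union> U'))) + int (card (support (U \<inter> U'))))
      \<le> int h * (int (card (support U)) + int (card (support U')))"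
    by (intro mult_left_mono) linarith+
  moreover have "card (token_colours (U \<union> U')) + card (token_colours (U \<inter> U')) \<le> card (token_colours U) + card (token_colours U')"
    unfolding token_colours_Un using card_Un_Int[OF ft] le(2) by linarith
  then have "min h (card (token_colours (U \<union> U'))) + min h (card (token_colours (U \<inter> U')))
      \<le> min h (card (token_colours U)) + min h (card (token_colours U'))"
    using le(2) tok_le by linarith
  ultimately show ?thesis unfolding sparsity_def distrib_left by linarith
qed

text \<open>
  The common vertex saves one \<open>h\<close> in the support, which pays for the second constant \<open>- h\<close>.
\<close>

lemma sparsity_Un_le:
  assumes "U \<subseteq> ground" "U' \<subseteq> ground" and ne: "support U \<inter> support U' \<noteq> {}"
  shows "sparsity (U \<union> U') \<le> sparsity U + sparsity U'"
proof -
  have fs: "finite (support U)" "finite (support U')" using assms finite_support by auto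
  have "1 \<le> card (support U \<inter> support U')" using fs ne by (simp add: Suc_le_eq card_gt_0_iff)
  then have "card (support (U \<union> U')) + 1 \<le> card (support U) + card (support U')"
    unfolding support_Un using card_Un_Int[OF fs] by linarith
  then have "int h * (int (card (support (U \<union> U'))) + 1)
      \<le> int h * (int (card (support U)) + int (card (support U')))"
    by (intro mult_left_mono) linarith+
  moreover have "card (token_colours (U \<union> U')) \<le> card (token_colours U) + card (token_colours U')"
    unfolding token_colours_Un by (rule card_Un_le)
  then have "min h (card (token_colours (U \<union> U'))) \<le> min h (card (token_colours U)) + min h (card (token_colours U'))"
    by linarith
  ultimately show ?thesis unfolding sparsity_def distrib_left by linarith
qed

lemma demand_le_sparsity:
  assumes U: "U \<subseteq> ground" "U \<noteq> {}"
  shows "demand U \<le> sparsity U"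
proof (cases "card U = 1")
  case True
  then obtain x where x: "U = {x}" by (rule card_1_singletonE)
  have "1 \<le> sparsity U"
  proof (cases x)
    case (Inl p)
    then obtain i v where "x = Inl (i, v)" by (cases p) simp
    then have "support U = {v}" "token_colours U = {i}" by (auto simp: support_def token_colours_def x)
    then show ?thesis using h_pos by (simp add: sparsity_def)
  next
    case (Inr e)
    then have e: "e \<in> E" using U x by (auto simp: ground_def)
    have "support U = ends e" by (auto simp: support_def x Inr)
    then have "int h * 2 \<le> int h * int (card (support U))"
      using ends_two[OF e] by (intro mult_left_mono) auto
    then show ?thesis using h_pos unfolding sparsity_def by linarith
  qed
  then show ?thesis using True by (simp add: demand_def)
qed (simp add: demand_def)

text \<open>
  Lowering the value at singletons changes it at hyperedges only: a single token has sparsity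
  \<open>h - h + min h 1 = 1\<close>.
\<close>

lemma demand_eq_sparsity:
  assumes U: "U \<subseteq> ground" "U \<noteq> {}" and not_edge: "\<nexists>e. U = {Inr e}"
  shows "demand U = sparsity U"
proof (cases "card U = 1")
  case True
  then obtain x where x: "U = {x}" by (rule card_1_singletonE)
  then obtain p where "x = Inl p" using not_edge by (cases x) auto
  then obtain i v where "x = Inl (i, v)" by (cases p) simp
  then have "support U = {v}" "token_colours U = {i}" by (auto simp: support_def token_colours_def x)
  then show ?thesis using h_pos True by (simp add: sparsity_def demand_def)
qed (simp add: demand_def)

sublocale intersecting_submodular ground demand
proof
  show "finite ground" by (rule finite_ground)
  show "demand (A \<union> B) + demand (A \<inter> B) \<le> demand A + demand B"
    if AB: "A \<subseteq> ground" "B \<subseteq> ground" "A \<inter> B \<noteq> {}" for A B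
  proof (cases "card A = 1 \<or> card B = 1")
    case True
    then have "A \<subseteq> B \<or> B \<subseteq> A" using AB(3) by (auto simp: card_1_singleton_iff)
    then have "A \<union> B = B \<and> A \<inter> B = A \<or> A \<union> B = A \<and> A \<inter> B = B" by auto
    then show ?thesis by auto
  next
    case False
    have "finite (A \<union> B)" using AB finite_ground finite_subset by blast
    have "card (A \<union> B) \<noteq> 1"
    proof
      assume "card (A \<union> B) = 1"
      then obtain x where "A \<union> B = {x}" by (rule card_1_singletonE)
      moreover have "A \<subseteq> A \<union> B" "A \<noteq> {}" using AB(3) by auto
      ultimately have "A = {x}" by (simp add: subset_singleton_iff)
      then show False using False by simp
    qed
    then show ?thesis
      using False sparsity_submodular[OF AB(1,2)] demand_le_sparsity[of "A \<inter> B"] AB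
      by (simp add: demand_def le_infI1)
  qed
  show "demand A \<le> demand B" if AB: "A \<noteq> {}" "A \<subseteq> B" "B \<subseteq> ground" for A B
  proof (cases "card B = 1")
    case True
    then have "A = B" using AB by (auto simp: card_1_singleton_iff)
    then show ?thesis by simp
  next
    case False
    have "demand A \<le> sparsity A" using AB by (intro demand_le_sparsity) auto
    also have "\<dots> \<le> sparsity B" using AB by (intro sparsity_mono)
    finally show ?thesis using False by (simp add: demand_def)
  qed
  show "0 \<le> demand A" if A: "A \<noteq> {}" "A \<subseteq> ground" for A
  proof -
    have "int h * 1 \<le> int h * int (card (support A))"
      using card_support_pos[OF A(2,1)] by (intro mult_left_mono) auto
    then show ?thesis by (simp add: demand_def sparsity_def)
  qed
qed

text \<open>
  Classes other than single hyperedges are merged as long as their supports overlap. Afterwards the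
  supports are disjoint and, together with singletons for the uncovered vertices, they form a partition
  \<open>P\<close> of \<open>V\<close>. As all tokens of colours in \<open>I\<close> are present, each of these classes contains all the
  colours of \<open>I\<close>. A hyperedge inside no member of \<open>P\<close> must be a class of its own, and it contributes 1.
\<close>

lemma demand_partition_bound:
  assumes I: "I \<subseteq> {1..k}" and E0: "E0 \<subseteq> E"
    and "partition_on (Inl ` (I \<times> V) \<union> Inr ` E0) \<U>"
  shows "\<exists>P. partition_on V P \<and>
    int h * int (card V) - int (card P) * (int h - int (min h (card I)))
      + int (card {e \<in> E0. \<not> (\<exists>X\<in>P. ends e \<subseteq> X)}) \<le> (\<Sum>U\<in>\<U>. demand U)"
  using assms(3)
proof (induction "card \<U>" arbitrary: \<U> rule: less_induct)
  case less
  let ?W = "Inl ` (I \<times> V) \<union> Inr ` E0"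
  have Wg: "?W \<subseteq> ground" using I E0 by (auto simp: ground_def)
  have fin: "finite \<U>"
    using finite_elements[OF finite_subset[OF Wg finite_ground] less.prems] .
  have UW: "U \<subseteq> ?W" "U \<subseteq> ground" "U \<noteq> {}" if "U \<in> \<U>" for U
    using partition_onD1[OF less.prems] partition_onD3[OF less.prems] that Wg by blast+
  define big where "big = {U \<in> \<U>. \<nexists>e. U = {Inr e}}"
  have finb: "finite big" using fin by (simp add: big_def)
  show ?case
  proof (cases "\<exists>U\<in>big. \<exists>U'\<in>big. U \<noteq> U' \<and> support U \<inter> support U' \<noteq> {}")
    case True
    then obtain U U' where U: "U \<in> big" "U' \<in> big" "U \<noteq> U'" "support U \<inter> support U' \<noteq> {}"
      by blast
    have UU: "U \<in> \<U>" "U' \<in> \<U>" using U by (auto simp: big_def)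
    have eq: "demand U = sparsity U" "demand U' = sparsity U'"
      using U UW[OF UU(1)] UW[OF UU(2)] by (auto simp: big_def intro!: demand_eq_sparsity)
    have "demand (U \<union> U') \<le> sparsity (U \<union> U')"
      using UW[OF UU(1)] UW[OF UU(2)] by (intro demand_le_sparsity) auto
    also have "\<dots> \<le> demand U + demand U'"
      unfolding eq using UW[OF UU(1)] UW[OF UU(2)] U(4) by (intro sparsity_Un_le)
    finally have le: "demand (U \<union> U') \<le> demand U + demand U'" .
    note merged = partition_on_merge[OF less.prems fin UU U(3) le]
    from less.hyps[OF merged(2,1)] merged(3) show ?thesis by (meson order_trans)
  next
    case False
    then have sep: "U = U'" if "U \<in> big" "U' \<in> big" "v \<in> support U" "v \<in> support U'" for U U' v
      using that by blast
    let ?c = "int (min h (card I))"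
    \<comment> \<open>An uncovered vertex exists only if there are no tokens, and then its singleton
      contributes nothing to the bound.\<close>
    define rest where "rest = V - (\<Union>U\<in>big. support U)"
    define P where "P = support ` big \<union> (\<lambda>v. {v}) ` rest"
    have suppV: "support U \<subseteq> V" "support U \<noteq> {}" if "U \<in> big" for U
      using that UW support_sub support_nonempty by (auto simp: big_def)
    have token_class: "\<exists>U\<in>big. Inl (i, v) \<in> U \<and> v \<in> support U" if "i \<in> I" "v \<in> V" for i v
    proof -
      have "Inl (i, v) \<in> ?W" using that by blast
      then obtain U where U: "U \<in> \<U>" "Inl (i, v) \<in> U" using partition_onD1[OF less.prems] by blast
      then have "U \<in> big" by (auto simp: big_def)
      then show ?thesis using U(2) unfolding support_def by blast
    qed
    have partP: "partition_on V P"
    proof (rule partition_onI)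
      show "\<Union>P = V" using suppV by (auto simp: P_def rest_def)
      show "{} \<notin> P" using suppV by (auto simp: P_def)
      show "disjnt X Y" if "X \<in> P" "Y \<in> P" "X \<noteq> Y" for X Y
        using that sep by (fastforce simp: P_def rest_def disjnt_def)
    qed
    have inj: "inj_on support big"
    proof (rule inj_onI)
      fix U U' assume UU: "U \<in> big" "U' \<in> big" "support U = support U'"
      obtain v where "v \<in> support U" using suppV(2)[OF UU(1)] by blast
      then show "U = U'" using sep UU by simp
    qed
    have colour: "token_colours U = I" if U: "U \<in> big" for U
    proof
      show "token_colours U \<subseteq> I" using UW[of U] U by (auto simp: token_colours_def big_def)
      obtain v where v: "v \<in> support U" using suppV(2)[OF U] by blast
      then have vV: "v \<in> V" using suppV(1)[OF U] by blast
      show "I \<subseteq> token_colours U"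
      proof
        fix i assume "i \<in> I"
        then obtain U' where "U' \<in> big" "Inl (i, v) \<in> U'" "v \<in> support U'"
          using token_class vV by blast
        moreover from this have "U' = U" using sep U v by blast
        ultimately show "i \<in> token_colours U" by (auto simp: token_colours_def)
      qed
    qed
    have rest_zero: "?c = 0" if "v \<in> rest" for v
    proof -
      have "I = {}" using token_class[of _ v] that by (auto simp: rest_def)
      then show ?thesis by simp
    qed
    define \<phi> where "\<phi> X = int h * int (card X) - int h + ?c" for X :: "'a set"
    have finP: "finite P" using finite_elements[OF finite_V partP] .
    have finr: "finite rest" using finite_V by (simp add: rest_def)
    have "(\<Sum>X\<in>P. int (card X)) = int (card V)"
      using sum_partition_on[OF partP finite_V, of "\<lambda>_. 1 :: int"] by simp
    then have "(\<Sum>X\<in>P. \<phi> X) = int h * int (card V) - int (card P) * (int h - ?c)"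
      by (simp add: \<phi>_def sum.distrib sum_subtractf sum_distrib_left[symmetric] algebra_simps)
    moreover have "(\<Sum>X\<in>P. \<phi> X) = (\<Sum>X\<in>support ` big. \<phi> X) + (\<Sum>X\<in>(\<lambda>v. {v}) ` rest. \<phi> X)"
      unfolding P_def using finb finr by (intro sum.union_disjoint) (auto simp: rest_def)
    moreover have "(\<Sum>X\<in>(\<lambda>v. {v}) ` rest. \<phi> X) = 0"
      using rest_zero by (intro sum.neutral) (auto simp: \<phi>_def)
    moreover have "(\<Sum>X\<in>support ` big. \<phi> X) = (\<Sum>U\<in>big. \<phi> (support U))"
      using inj by (simp add: sum.reindex)
    moreover have "(\<Sum>U\<in>big. \<phi> (support U)) = (\<Sum>U\<in>big. demand U)"
    proof (rule sum.cong[OF refl])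
      fix U assume U: "U \<in> big"
      then have "demand U = sparsity U"
        using UW[of U] by (intro demand_eq_sparsity) (auto simp: big_def)
      then show "\<phi> (support U) = demand U" using colour[OF U] by (simp add: \<phi>_def sparsity_def)
    qed
    moreover have "(\<Sum>U\<in>\<U>. demand U) = (\<Sum>U\<in>\<U> - big. demand U) + (\<Sum>U\<in>big. demand U)"
      using fin by (intro sum.subset_diff) (auto simp: big_def)
    moreover have "(\<Sum>U\<in>\<U> - big. demand U) = (\<Sum>U\<in>\<U> - big. 1)"
      by (intro sum.cong[OF refl]) (auto simp: big_def demand_def)
    moreover have "card {e \<in> E0. \<not> (\<exists>X\<in>P. ends e \<subseteq> X)} \<le> card (\<U> - big)"
    proof (rule card_inj_on_le)
      show "inj_on (\<lambda>e. {Inr e}) {e \<in> E0. \<not> (\<exists>X\<in>P. ends e \<subseteq> X)}" by (auto simp: inj_on_def)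
      show "(\<lambda>e. {Inr e}) ` {e \<in> E0. \<not> (\<exists>X\<in>P. ends e \<subseteq> X)} \<subseteq> \<U> - big"
      proof (rule image_subsetI)
        fix e assume e: "e \<in> {e \<in> E0. \<not> (\<exists>X\<in>P. ends e \<subseteq> X)}"
        then have "Inr e \<in> ?W" by blast
        then obtain U where U: "U \<in> \<U>" "Inr e \<in> U" using partition_onD1[OF less.prems] by blast
        have "U \<notin> big"
        proof
          assume "U \<in> big"
          moreover have "ends e \<subseteq> support U" using U(2) by (auto simp: support_def)
          ultimately show False using e by (auto simp: P_def)
        qed
        moreover from this have "U = {Inr e}" using U by (auto simp: big_def)
        ultimately show "{Inr e} \<in> \<U> - big" using U(1) by simp
      qed
      show "finite (\<U> - big)" using fin by simp
    qed
    ultimately show ?thesis using partP by (intro exI[of _ P]) simp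
  qed
qed

text \<open>
  The indices are \<open>m i\<close> copies of each colour \<open>i\<close>, to be represented by tokens of that colour, and
  \<open>h * card V - (\<Sum>i=1..k. m i)\<close> copies of the set of all hyperedges. For a set of indices that involves
  the colours \<open>I\<close>, Rado's condition follows from the assumption on partitions if hyperedges are involved
  and \<open>card I < h\<close>, and from \<open>m_le\<close> and \<open>m_sum\<close> in the other cases.
\<close>

lemma tight_roots_exist:
  assumes m_le: "\<And>i. i \<in> {1..k} \<Longrightarrow> m i \<le> card V" and m_sum: "(\<Sum>i=1..k. m i) \<le> h * card V"
    and cond: "\<And>P. partition_on V P \<Longrightarrow>
      h * card P \<le> (\<Sum>i=1..k. min (m i) (card P)) + card {e \<in> E. \<not> (\<exists>X\<in>P. ends e \<subseteq> X)}"
  shows "\<exists>S E'. (\<forall>i\<in>{1..k}. S i \<subseteq> V \<and> card (S i) = m i) \<and> E' \<subseteq> E \<and>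
    card E' + (\<Sum>i=1..k. m i) = h * card V \<and>
    (\<forall>X\<subseteq>V. X \<noteq> {} \<longrightarrow> (\<Sum>i=1..k. card (S i \<inter> X)) + card {e \<in> E'. ends e \<subseteq> X} + h
      \<le> h * card X + min h (card {i \<in> {1..k}. S i \<inter> X \<noteq> {}}))"
proof -
  define q where "q = h * card V - (\<Sum>i=1..k. m i)"
  define J where "J = Inl ` (SIGMA i:{1..k}. {..<m i}) \<union> (Inr ` {..<q} :: ((nat \<times> nat) + nat) set)"
  define A where "A j = (case j of Inl (i, t) \<Rightarrow> Inl ` ({i} \<times> V) | Inr s \<Rightarrow> Inr ` E)"
    for j :: "(nat \<times> nat) + nat"
  have A_simps: "A (Inl (i, t)) = Inl ` ({i} \<times> V)" "A (Inr s) = Inr ` E" for i t s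
    by (simp_all add: A_def)
  have finJ: "finite J" by (simp add: J_def)
  have Ag: "A j \<subseteq> ground" if "j \<in> J" for j
    using that by (auto simp: J_def A_simps ground_def)
  \<comment> \<open>Enlarging \<open>K\<close> to all copies of the sets it involves does not change the union,
    so only the colours in \<open>K\<close> and the presence of a hyperedge index matter.\<close>
  have hall: "int (card K) \<le> truncation (\<Union>j\<in>K. A j)" if K: "K \<subseteq> J" for K
  proof -
    define I where "I = {i. \<exists>t. Inl (i, t) \<in> K}"
    define flag where "flag = (\<exists>s. Inr s \<in> K)"
    define E0 where "E0 = (if flag then E else {})"
    define q0 where "q0 = (if flag then q else 0)"
    have I: "I \<subseteq> {1..k}" using K by (auto simp: I_def J_def)
    have finI: "finite I" using I finite_subset by blast
    have "K \<subseteq> Inl ` (SIGMA i:I. {..<m i}) \<union> Inr ` {..<q0}"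
    proof
      fix j assume j: "j \<in> K"
      then have "j \<in> J" using K by blast
      then show "j \<in> Inl ` (SIGMA i:I. {..<m i}) \<union> Inr ` {..<q0}"
        using j by (auto simp: J_def I_def q0_def flag_def)
    qed
    then have "card K \<le> card (Inl ` (SIGMA i:I. {..<m i}) \<union> (Inr ` {..<q0} :: ((nat \<times> nat) + nat) set))"
      using finI by (intro card_mono) auto
    also have "\<dots> \<le> card (Inl ` (SIGMA i:I. {..<m i}) :: ((nat \<times> nat) + nat) set)
        + card (Inr ` {..<q0} :: ((nat \<times> nat) + nat) set)"
      by (rule card_Un_le)
    also have "\<dots> = (\<Sum>i\<in>I. m i) + q0"
      using finI by (simp add: card_image)
    finally have cardK: "card K \<le> (\<Sum>i\<in>I. m i) + q0" .
    have union: "(\<Union>j\<in>K. A j) = Inl ` (I \<times> V) \<union> Inr ` E0"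
    proof
      show "(\<Union>j\<in>K. A j) \<subseteq> Inl ` (I \<times> V) \<union> Inr ` E0"
      proof (rule UN_least)
        fix j assume j: "j \<in> K"
        show "A j \<subseteq> Inl ` (I \<times> V) \<union> Inr ` E0"
        proof (cases j)
          case (Inl p)
          then obtain i t where p: "p = (i, t)" by (cases p)
          then have "i \<in> I" using j Inl by (auto simp: I_def)
          then show ?thesis using Inl p by (auto simp: A_simps)
        next
          case (Inr s)
          then have "flag" using j by (auto simp: flag_def)
          then show ?thesis using Inr by (auto simp: A_simps E0_def)
        qed
      qed
      show "Inl ` (I \<times> V) \<union> Inr ` E0 \<subseteq> (\<Union>j\<in>K. A j)"
      proof
        fix x assume "x \<in> Inl ` (I \<times> V) \<union> Inr ` E0"
        then consider i v where "x = Inl (i, v)" "i \<in> I" "v \<in> V" | e where "x = Inr e" "e \<in> E0" by auto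
        then show "x \<in> (\<Union>j\<in>K. A j)"
        proof cases
          case 1
          then obtain t where "Inl (i, t) \<in> K" by (auto simp: I_def)
          moreover have "x \<in> A (Inl (i, t))" using 1 by (simp add: A_simps)
          ultimately show ?thesis by blast
        next
          case 2
          then have "flag" "e \<in> E" by (auto simp: E0_def split: if_splits)
          then obtain s where "Inr s \<in> K" by (auto simp: flag_def)
          moreover have "x \<in> A (Inr s)" using 2 \<open>e \<in> E\<close> by (simp add: A_simps)
          ultimately show ?thesis by blast
        qed
      qed
    qed
    have sub: "(\<Union>j\<in>K. A j) \<subseteq> ground" using K Ag by blast
    obtain \<U> where \<U>: "partition_on (\<Union>j\<in>K. A j) \<U>"
      "truncation (\<Union>j\<in>K. A j) = (\<Sum>U\<in>\<U>. demand U)"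
      using truncation_attained[OF sub] .
    have E0: "E0 \<subseteq> E" by (simp add: E0_def)
    obtain P where P: "partition_on V P"
      and bound: "int h * int (card V) - int (card P) * (int h - int (min h (card I)))
        + int (card {e \<in> E0. \<not> (\<exists>X\<in>P. ends e \<subseteq> X)}) \<le> truncation (\<Union>j\<in>K. A j)"
      using demand_partition_bound[OF I E0 \<U>(1)[unfolded union]] unfolding \<U>(2) by blast
    define n p where "n = card V" and "p = card P"
    have split: "(\<Sum>i=1..k. g i) = (\<Sum>i\<in>I. g i) + (\<Sum>i\<in>{1..k} - I. g i)" for g :: "nat \<Rightarrow> nat"
      using sum.subset_diff[OF I, of g] by simp
    have total: "(\<Sum>i=1..k. m i) + q = h * n" using m_sum by (simp add: q_def n_def)
    have pn: "p \<le> n" unfolding p_def n_def by (rule card_partition_le[OF P finite_V])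
    have "int ((\<Sum>i\<in>I. m i) + q0) \<le> int h * int n - int p * (int h - int (min h (card I)))
        + int (card {e \<in> E0. \<not> (\<exists>X\<in>P. ends e \<subseteq> X)})"
    proof (cases "h \<le> card I")
      case True
      have "(\<Sum>i\<in>I. m i) + q0 \<le> h * n" using total split[of m] by (simp add: q0_def)
      then have "int ((\<Sum>i\<in>I. m i) + q0) \<le> int h * int n" by (metis of_nat_le_iff of_nat_mult)
      then show ?thesis using True by (simp add: min_absorb1)
    next
      case few: False
      then have min: "min h (card I) = card I" by simp
      show ?thesis
      proof (cases flag)
        case True
        have "(\<Sum>i\<in>I. min (m i) p) \<le> (\<Sum>i\<in>I. p)" by (intro sum_mono) simp
        moreover have "(\<Sum>i\<in>{1..k} - I. min (m i) p) \<le> (\<Sum>i\<in>{1..k} - I. m i)" by (intro sum_mono) simp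
        ultimately have "(\<Sum>i=1..k. min (m i) p) \<le> card I * p + (\<Sum>i\<in>{1..k} - I. m i)"
          using split[of "\<lambda>i. min (m i) p"] by simp
        then have "h * p \<le> card I * p + (\<Sum>i\<in>{1..k} - I. m i)
            + card {e \<in> E. \<not> (\<exists>X\<in>P. ends e \<subseteq> X)}"
          using cond[OF P] by (simp add: p_def)
        then have "h * p + ((\<Sum>i\<in>I. m i) + q) \<le> card I * p + h * n
            + card {e \<in> E. \<not> (\<exists>X\<in>P. ends e \<subseteq> X)}"
          using total split[of m] by simp
        then have "int (h * p + ((\<Sum>i\<in>I. m i) + q)) \<le> int (card I * p + h * n
            + card {e \<in> E. \<not> (\<exists>X\<in>P. ends e \<subseteq> X)})" by (simp only: of_nat_le_iff)
        then show ?thesis using True unfolding min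
          by (simp add: q0_def E0_def right_diff_distrib mult.commute)
      next
        case False
        have "(\<Sum>i\<in>I. m i) \<le> (\<Sum>i\<in>I. n)" using I m_le by (intro sum_mono) (auto simp: n_def)
        then have "(\<Sum>i\<in>I. m i) \<le> card I * n" by simp
        then have "int (\<Sum>i\<in>I. m i) \<le> int (card I * n)" by (simp only: of_nat_le_iff)
        moreover have "int p * (int h - int (card I)) \<le> int n * (int h - int (card I))"
          using pn few by (intro mult_right_mono) auto
        ultimately show ?thesis using False unfolding min
          by (simp add: q0_def E0_def right_diff_distrib mult.commute)
      qed
    qed
    moreover have "int (card K) \<le> int ((\<Sum>i\<in>I. m i) + q0)"
      using cardK by (simp only: of_nat_le_iff)
    ultimately show ?thesis using bound unfolding n_def p_def by linarith
  qed
  have "\<exists>a. (\<forall>j\<in>J. a j \<in> A j) \<and> (\<forall>K\<subseteq>J. int (card K) \<le> truncation (a ` K))"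
    by (rule rado_transversal[OF finJ finite_ground Ag _ truncation_mono truncation_submodular hall])
      (simp_all add: truncation_empty)
  then obtain a where a: "\<And>j. j \<in> J \<Longrightarrow> a j \<in> A j"
    and indep: "\<And>K. K \<subseteq> J \<Longrightarrow> int (card K) \<le> truncation (a ` K)"
    by blast
  have aJ: "a ` J \<subseteq> ground" using a Ag by blast
  have inj: "inj_on a J"
  proof (rule inj_onI, rule ccontr)
    fix j j' assume j: "j \<in> J" "j' \<in> J" "a j = a j'" "j \<noteq> j'"
    \<comment> \<open>A repeated representative would have demand at least 2.\<close>
    have "int (card {j, j'}) \<le> truncation (a ` {j, j'})" using j by (intro indep) auto
    also have "\<dots> = truncation {a j}" using j by simp
    also have "\<dots> \<le> demand {a j}" using j aJ by (intro truncation_le_self) auto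
    finally show False using j by (simp add: demand_def)
  qed
  have sparse: "int (card F) \<le> sparsity F" if F: "F \<subseteq> a ` J" "F \<noteq> {}" for F
  proof -
    define K where "K = {j \<in> J. a j \<in> F}"
    have FK: "F = a ` K" using F by (auto simp: K_def)
    have "card F \<le> card K" unfolding FK using finJ by (intro card_image_le) (simp add: K_def)
    moreover have "int (card K) \<le> truncation F"
      unfolding FK by (rule indep) (simp add: K_def)
    ultimately have "int (card F) \<le> truncation F" by linarith
    also have "\<dots> \<le> demand F" using F aJ by (intro truncation_le_self) auto
    also have "\<dots> \<le> sparsity F" using F aJ by (intro demand_le_sparsity) auto
    finally show ?thesis .
  qed
  define S where "S i = {v. Inl (i, v) \<in> a ` J}" for i
  define E' where "E' = {e. Inr e \<in> a ` J}"
  have S_sub: "S i \<subseteq> V" for i using aJ by (auto simp: S_def ground_def)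
  have E'_sub: "E' \<subseteq> E" using aJ by (auto simp: E'_def ground_def)
  have finE': "finite E'" using E'_sub finite_E finite_subset by blast
  have finS: "finite (S i)" for i using S_sub finite_V finite_subset by blast
  have cardS: "card (S i) = m i" if i: "i \<in> {1..k}" for i
  proof -
    have "(\<lambda>v. Inl (i, v)) ` S i = a ` (Inl ` ({i} \<times> {..<m i}))"
    proof
      show "(\<lambda>v. Inl (i, v)) ` S i \<subseteq> a ` (Inl ` ({i} \<times> {..<m i}))"
      proof (rule image_subsetI)
        fix v assume "v \<in> S i"
        then obtain j where j: "j \<in> J" "a j = Inl (i, v)" by (auto simp: S_def)
        then have "Inl (i, v) \<in> A j" using a by metis
        then have "j \<in> Inl ` ({i} \<times> {..<m i})" using j(1) by (auto simp: J_def A_simps)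
        then show "Inl (i, v) \<in> a ` (Inl ` ({i} \<times> {..<m i}))" using j(2) by (metis imageI)
      qed
      show "a ` (Inl ` ({i} \<times> {..<m i})) \<subseteq> (\<lambda>v. Inl (i, v)) ` S i"
      proof
        fix x assume "x \<in> a ` (Inl ` ({i} \<times> {..<m i}))"
        then obtain t where t: "t < m i" "x = a (Inl (i, t))" by auto
        then have "Inl (i, t) \<in> J" using i by (auto simp: J_def)
        then have "x \<in> Inl ` ({i} \<times> V)" "x \<in> a ` J" using a[of "Inl (i, t)"] t by (auto simp: A_simps)
        then show "x \<in> (\<lambda>v. Inl (i, v)) ` S i" by (auto simp: S_def)
      qed
    qed
    moreover have "card ((\<lambda>v. Inl (i, v) :: (nat \<times> 'a) + 'e) ` S i) = card (S i)"
      by (intro card_image) (auto simp: inj_on_def)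
    moreover have "inj_on a (Inl ` ({i} \<times> {..<m i}))"
      using i by (intro inj_on_subset[OF inj]) (auto simp: J_def)
    then have "card (a ` (Inl ` ({i} \<times> {..<m i}))) = m i" by (simp add: card_image)
    ultimately show ?thesis by simp
  qed
  have cardE': "card E' = q"
  proof -
    have "Inr ` E' = a ` (Inr ` {..<q})"
    proof
      show "Inr ` E' \<subseteq> a ` (Inr ` {..<q})"
      proof (rule image_subsetI)
        fix e assume "e \<in> E'"
        then obtain j where j: "j \<in> J" "a j = Inr e" by (auto simp: E'_def)
        then have "Inr e \<in> A j" using a by metis
        then have "j \<in> Inr ` {..<q}" using j(1) by (auto simp: J_def A_simps)
        then show "Inr e \<in> a ` (Inr ` {..<q})" using j(2) by (metis imageI)
      qed
      show "a ` (Inr ` {..<q}) \<subseteq> Inr ` E'"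
      proof
        fix x assume "x \<in> a ` (Inr ` {..<q})"
        then obtain t where t: "t < q" "x = a (Inr t)" by auto
        then have "Inr t \<in> J" by (auto simp: J_def)
        then have "x \<in> Inr ` E" "x \<in> a ` J" using a[of "Inr t"] t by (auto simp: A_simps)
        then show "x \<in> Inr ` E'" by (auto simp: E'_def)
      qed
    qed
    moreover have "card (Inr ` E' :: ((nat \<times> 'a) + 'e) set) = card E'"
      by (intro card_image) (auto simp: inj_on_def)
    moreover have "inj_on a (Inr ` {..<q})" by (intro inj_on_subset[OF inj]) (auto simp: J_def)
    then have "card (a ` (Inr ` {..<q})) = q" by (simp add: card_image)
    ultimately show ?thesis by simp
  qed
  have "(\<Sum>i=1..k. card (S i \<inter> X)) + card {e \<in> E'. ends e \<subseteq> X} + h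
      \<le> h * card X + min h (card {i \<in> {1..k}. S i \<inter> X \<noteq> {}})" if X: "X \<subseteq> V" "X \<noteq> {}" for X
  proof -
    define F :: "((nat \<times> 'a) + 'e) set" where
      "F = Inl ` (SIGMA i:{1..k}. S i \<inter> X) \<union> Inr ` {e \<in> E'. ends e \<subseteq> X}"
    have finX: "finite X" using X finite_V finite_subset by blast
    have cardF: "card F = (\<Sum>i=1..k. card (S i \<inter> X)) + card {e \<in> E'. ends e \<subseteq> X}"
    proof -
      have "card F = card (Inl ` (SIGMA i:{1..k}. S i \<inter> X) :: ((nat \<times> 'a) + 'e) set)
          + card (Inr ` {e \<in> E'. ends e \<subseteq> X} :: ((nat \<times> 'a) + 'e) set)"
        unfolding F_def using finS finE' by (intro card_Un_disjoint) auto
      then show ?thesis using finS by (simp add: card_image)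
    qed
    have F_sub: "F \<subseteq> a ` J" by (auto simp: F_def S_def E'_def)
    show ?thesis
    proof (cases "F = {}")
      case True
      have "h * 1 \<le> h * card X" using X finX by (intro mult_left_mono) (auto simp: Suc_le_eq card_gt_0_iff)
      moreover have "card F = 0" using True by simp
      ultimately show ?thesis using cardF by linarith
    next
      case False
      have "support F \<subseteq> X" by (auto simp: F_def support_def)
      then have "card (support F) \<le> card X" using finX by (intro card_mono)
      then have "h * card (support F) \<le> h * card X" by simp
      moreover have "card (token_colours F) \<le> card {i \<in> {1..k}. S i \<inter> X \<noteq> {}}"
        by (intro card_mono) (auto simp: F_def token_colours_def)
      then have "min h (card (token_colours F)) \<le> min h (card {i \<in> {1..k}. S i \<inter> X \<noteq> {}})" by linarith
      moreover have "int (card F + h) \<le> int (h * card (support F) + min h (card (token_colours F)))"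
        using sparse[OF F_sub False] unfolding sparsity_def by simp
      then have "card F + h \<le> h * card (support F) + min h (card (token_colours F))"
        by (simp only: of_nat_le_iff)
      ultimately show ?thesis using cardF by linarith
    qed
  qed
  then show ?thesis
    using S_sub cardS E'_sub cardE' m_sum
    by (intro exI[of _ S] exI[of _ E']) (auto simp: q_def)
qed

text \<open>
  Give the vertex \<open>v\<close> the in-degree \<open>x v = h - z v\<close>, where \<open>z v\<close> is its number of tokens. Sparsity implies
  Hall's condition for assigning the hyperedges to in-degree slots. All slots get used, so \<open>X\<close> receives
  at least \<open>\<Sum>v\<in>X. x v\<close> heads. A hyperarc with its head in \<open>X\<close> enters \<open>X\<close> unless its hyperedge lies
  inside \<open>X\<close>, and sparsity bounds the number of these exceptions.
\<close>

lemma covering_orientation_exists: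
  assumes S: "\<And>i. i \<in> {1..k} \<Longrightarrow> S i \<subseteq> V" and E': "E' \<subseteq> E"
    and total: "card E' + (\<Sum>i=1..k. card (S i)) = h * card V"
    and sparse: "\<And>X. X \<subseteq> V \<Longrightarrow> X \<noteq> {} \<Longrightarrow>
      (\<Sum>i=1..k. card (S i \<inter> X)) + card {e \<in> E'. ends e \<subseteq> X} + h
      \<le> h * card X + min h (card {i \<in> {1..k}. S i \<inter> X \<noteq> {}})"
  shows "\<exists>r. (\<forall>e\<in>E'. r e \<in> ends e) \<and> (\<forall>v\<in>V. card {i \<in> {1..k}. v \<in> S i} \<le> h) \<and>
    (\<forall>X\<subseteq>V. X \<noteq> {} \<longrightarrow> h \<le> card {i \<in> {1..k}. S i \<inter> X \<noteq> {}}
      + card {e \<in> E'. r e \<in> X \<and> \<not> ends e - {r e} \<subseteq> X})"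
proof -
  define z where "z v = card {i \<in> {1..k}. v \<in> S i}" for v
  have finE': "finite E'" using E' finite_E finite_subset by blast
  have z_sum: "(\<Sum>i=1..k. card (S i \<inter> X)) = (\<Sum>v\<in>X. z v)" if "X \<subseteq> V" for X
  proof -
    have "S i \<inter> X = {v \<in> X. v \<in> S i}" for i by auto
    then have "(\<Sum>i=1..k. card (S i \<inter> X)) = (\<Sum>i=1..k. card {v \<in> X. v \<in> S i})" by simp
    also have "\<dots> = (\<Sum>v\<in>X. z v)"
      using that finite_V finite_subset by (intro sum_multicount_gen) (auto simp: z_def)
    finally show ?thesis .
  qed
  have z_le: "z v \<le> h" if "v \<in> V" for v
  proof -
    have "(\<Sum>i=1..k. card (S i \<inter> {v})) = z v" using z_sum[of "{v}"] that by simp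
    then show ?thesis using sparse[of "{v}"] that by simp
  qed
  define x where "x v = h - z v" for v
  have x_sum: "(\<Sum>v\<in>X. x v) + (\<Sum>i=1..k. card (S i \<inter> X)) = h * card X" if X: "X \<subseteq> V" for X
  proof -
    have "(\<Sum>v\<in>X. x v) + (\<Sum>v\<in>X. z v) = (\<Sum>v\<in>X. h)"
      unfolding sum.distrib[symmetric] using X z_le by (intro sum.cong[OF refl]) (auto simp: x_def)
    then show ?thesis using z_sum[OF X] by simp
  qed
  have S_V: "S i \<inter> V = S i" if "i \<in> {1..k}" for i using S[OF that] by blast
  have x_total: "(\<Sum>v\<in>V. x v) = card E'"
    using x_sum[of V] total S_V by simp
  define A where "A e = (SIGMA v:ends e. {..<x v})" for e
  have "\<exists>a. (\<forall>e\<in>E'. a e \<in> A e) \<and> inj_on a E'"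
  proof (rule hall_marriage)
    show "finite E'" by (rule finE')
    show "finite (A e)" if "e \<in> E'" for e
      using finite_subset[OF ends_sub finite_V] that E' by (auto simp: A_def)
    show "card K \<le> card (\<Union>e\<in>K. A e)" if K: "K \<subseteq> E'" for K
    proof (cases "K = {}")
      case False
      define Y where "Y = (\<Union>e\<in>K. ends e)"
      have "ends e \<subseteq> V" "ends e \<noteq> {}" if "e \<in> K" for e
        using that K E' ends_sub[of e] ends_ne[of e] by auto
      then have Y: "Y \<subseteq> V" "Y \<noteq> {}" using False unfolding Y_def by (auto simp: UN_subset_iff)
      have finY: "finite Y" using Y finite_V finite_subset by blast
      have "(\<Union>e\<in>K. A e) = (SIGMA v:Y. {..<x v})" by (auto simp: A_def Y_def)
      then have "card (\<Union>e\<in>K. A e) = (\<Sum>v\<in>Y. x v)" using finY by simp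
      moreover have "card K \<le> card {e \<in> E'. ends e \<subseteq> Y}"
        using K finE' by (intro card_mono) (auto simp: Y_def)
      ultimately show ?thesis using sparse[OF Y] x_sum[OF Y(1)] by linarith
    qed simp
  qed
  then obtain a where a: "\<And>e. e \<in> E' \<Longrightarrow> a e \<in> A e" and inj: "inj_on a E'" by blast
  define r where "r e = fst (a e)" for e
  have r: "r e \<in> ends e" if "e \<in> E'" for e using a[OF that] by (auto simp: r_def A_def)
  have in_le: "card {e \<in> E'. r e \<in> Z} \<le> (\<Sum>v\<in>Z. x v)" if "Z \<subseteq> V" for Z
  proof -
    have finZ: "finite Z" using that finite_V finite_subset by blast
    have "card {e \<in> E'. r e \<in> Z} \<le> card (SIGMA v:Z. {..<x v})"
    proof (rule card_inj_on_le)
      show "inj_on a {e \<in> E'. r e \<in> Z}" using inj by (rule inj_on_subset) auto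
      show "a ` {e \<in> E'. r e \<in> Z} \<subseteq> (SIGMA v:Z. {..<x v})" using a by (fastforce simp: r_def A_def)
      show "finite (SIGMA v:Z. {..<x v})" using finZ by simp
    qed
    then show ?thesis using finZ by simp
  qed
  have "h \<le> card {i \<in> {1..k}. S i \<inter> X \<noteq> {}} + card {e \<in> E'. r e \<in> X \<and> \<not> ends e - {r e} \<subseteq> X}"
    if X: "X \<subseteq> V" "X \<noteq> {}" for X
  proof -
    have "E' = {e \<in> E'. r e \<in> X} \<union> {e \<in> E'. r e \<in> V - X}" using r E' ends_sub by blast
    then have "card E' \<le> card {e \<in> E'. r e \<in> X} + card {e \<in> E'. r e \<in> V - X}"
      by (metis card_Un_le)
    moreover have "(\<Sum>v\<in>V. x v) = (\<Sum>v\<in>V - X. x v) + (\<Sum>v\<in>X. x v)"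
      using X finite_V by (intro sum.subset_diff)
    ultimately have in_ge: "(\<Sum>v\<in>X. x v) \<le> card {e \<in> E'. r e \<in> X}"
      using in_le[of "V - X"] x_total by simp
    let ?inside = "{e \<in> E'. ends e \<subseteq> X}" and ?entering = "{e \<in> E'. r e \<in> X \<and> \<not> ends e - {r e} \<subseteq> X}"
    have "card {e \<in> E'. r e \<in> X} \<le> card (?inside \<union> ?entering)"
      using finE' by (intro card_mono) auto
    also have "\<dots> \<le> card ?inside + card ?entering" by (rule card_Un_le)
    finally have "card {e \<in> E'. r e \<in> X} \<le> card ?inside + card ?entering" .
    then show ?thesis using in_ge sparse[OF X] x_sum[OF X(1)] by linarith
  qed
  then show ?thesis using r z_le unfolding z_def by blast
qed

end

section \<open>Packing branchings in an oriented hypergraph\<close>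

text \<open>
  The vertex set \<open>D\<close> arises from the root set \<open>S\<close> by adding the heads of the hyperarcs in \<open>F\<close>, each
  with a tail that was added before it or lies in \<open>S\<close>. The trimming \<open>t\<close> selects these tails, and \<open>rk\<close> records the
  order of the additions, which excludes circuits.
\<close>

definition grown ::
    "('e \<Rightarrow> 'a) \<Rightarrow> ('e \<Rightarrow> 'a set) \<Rightarrow> 'a set \<Rightarrow> 'e set \<Rightarrow> 'a set \<Rightarrow> bool" where
  "grown hv ts S F D \<longleftrightarrow> S \<subseteq> D \<and> inj_on hv F \<and> hv ` F = D - S \<and>
     (\<exists>t rk. \<forall>a\<in>F. t a \<in> ts a \<inter> D \<and> (rk (t a) :: nat) < rk (hv a))"

lemma grown_refl: "grown hv ts S {} S"
  by (simp add: grown_def)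

text \<open>
  The new hyperarc is the first one added to \<open>S\<close>, so the ranks of all later vertices are
  shifted by one and the vertices of \<open>S\<close> get rank 0.
\<close>

lemma grown_step:
  assumes g: "grown hv ts (insert (hv a) S) F D" and a: "hv a \<notin> S" "a \<notin> F"
    and u: "u \<in> ts a" "u \<in> S"
  shows "grown hv ts S (insert a F) D"
proof -
  obtain t rk where t: "\<forall>b\<in>F. t b \<in> ts b \<inter> D \<and> (rk (t b) :: nat) < rk (hv b)"
    and D: "insert (hv a) S \<subseteq> D" "inj_on hv F" "hv ` F = D - insert (hv a) S"
    using g unfolding grown_def by blast
  define rk' where "rk' x = (if x \<in> S then 0 else Suc (rk x))" for x
  have "\<forall>b\<in>insert a F. (t(a := u)) b \<in> ts b \<inter> D \<and> rk' ((t(a := u)) b) < rk' (hv b)"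
  proof
    fix b assume "b \<in> insert a F"
    show "(t(a := u)) b \<in> ts b \<inter> D \<and> rk' ((t(a := u)) b) < rk' (hv b)"
    proof (cases "b = a")
      case True
      then show ?thesis using u a D by (auto simp: rk'_def)
    next
      case False
      then have "b \<in> F" using \<open>b \<in> insert a F\<close> by simp
      then have "hv b \<notin> S" "t b \<in> ts b \<inter> D" "rk (t b) < rk (hv b)" using D t by blast+
      then show ?thesis using False by (simp add: rk'_def)
    qed
  qed
  moreover have "inj_on hv (insert a F)" "hv ` insert a F = D - S" using D a by auto
  ultimately show ?thesis using D unfolding grown_def by blast
qed

text \<open>
  \<open>C i\<close> below is the current vertex set of the \<open>i\<close>-th hyperbranching, and \<open>A\<close> the set of hyperarcs that
  are still unused.
\<close>

locale coloured_dypergraph =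
  fixes V :: "'a set" and I :: "'i set" and hv :: "'e \<Rightarrow> 'a" and ts :: "'e \<Rightarrow> 'a set" and h :: nat
  assumes finite_V: "finite V" and finite_I: "finite I"
begin

definition colours :: "('i \<Rightarrow> 'a set) \<Rightarrow> 'a set \<Rightarrow> 'i set" where
  "colours C X = {i \<in> I. C i \<inter> X \<noteq> {}}"

definition entering :: "'e set \<Rightarrow> 'a set \<Rightarrow> 'e set" where
  "entering A X = {a \<in> A. hv a \<in> X \<and> \<not> ts a \<subseteq> X}"

definition tight :: "('i \<Rightarrow> 'a set) \<Rightarrow> 'e set \<Rightarrow> 'a set \<Rightarrow> bool" where
  "tight C A X \<longleftrightarrow> card (colours C X) + card (entering A X) = h"

definition covered :: "('i \<Rightarrow> 'a set) \<Rightarrow> 'e set \<Rightarrow> bool" where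
  "covered C A \<longleftrightarrow> (\<forall>X\<subseteq>V. X \<noteq> {} \<longrightarrow> h \<le> card (colours C X) + card (entering A X))"

lemma finite_colours: "finite (colours C X)"
  using finite_I by (simp add: colours_def)

lemma colours_mono: "X \<subseteq> Y \<Longrightarrow> colours C X \<subseteq> colours C Y"
  by (auto simp: colours_def)

lemma entering_submodular:
  assumes "finite A"
  shows "card (entering A (X \<union> Y)) + card (entering A (X \<inter> Y))
    \<le> card (entering A X) + card (entering A Y)"
proof -
  have fin: "finite (entering A Z)" for Z using assms by (simp add: entering_def)
  have "entering A (X \<union> Y) \<union> entering A (X \<inter> Y) \<subseteq> entering A X \<union> entering A Y"
    "entering A (X \<union> Y) \<inter> entering A (X \<inter> Y) \<subseteq> entering A X \<inter> entering A Y"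
    unfolding entering_def by blast+
  then have "card (entering A (X \<union> Y) \<union> entering A (X \<inter> Y)) \<le> card (entering A X \<union> entering A Y)"
    "card (entering A (X \<union> Y) \<inter> entering A (X \<inter> Y)) \<le> card (entering A X \<inter> entering A Y)"
    using fin by (intro card_mono; simp)+
  then show ?thesis
    using card_Un_Int[OF fin fin, of "X \<union> Y" "X \<inter> Y"] card_Un_Int[OF fin fin, of X Y] by linarith
qed

text \<open>
  Both the number of colours and the in-degree are submodular. Equality throughout at two tight sets
  shows that the intersection is tight and that no colour common to both gets lost in it.
\<close>

lemma tight_Int:
  assumes cov: "covered C A" and A: "finite A" and X: "X \<subseteq> V" "tight C A X"
    and Y: "Y \<subseteq> V" "tight C A Y" and ne: "X \<inter> Y \<noteq> {}"
  shows "tight C A (X \<inter> Y)" "colours C (X \<inter> Y) = colours C X \<inter> colours C Y"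
proof -
  have un: "colours C (X \<union> Y) = colours C X \<union> colours C Y"
    unfolding colours_def by blast
  have sub: "colours C (X \<inter> Y) \<subseteq> colours C X \<inter> colours C Y"
    unfolding colours_def by blast
  have fin: "finite (colours C X \<inter> colours C Y)" using finite_colours by simp
  have le: "card (colours C (X \<inter> Y)) \<le> card (colours C X \<inter> colours C Y)"
    using card_mono[OF fin sub] .
  have sum: "card (colours C (X \<union> Y)) + card (colours C X \<inter> colours C Y)
      = card (colours C X) + card (colours C Y)"
    unfolding un using card_Un_Int[OF finite_colours finite_colours, of C X C Y] by simp
  have "X \<inter> Y \<subseteq> V" "X \<union> Y \<subseteq> V" "X \<union> Y \<noteq> {}" using X Y ne by auto
  then have "h \<le> card (colours C (X \<inter> Y)) + card (entering A (X \<inter> Y))"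
    "h \<le> card (colours C (X \<union> Y)) + card (entering A (X \<union> Y))"
    using cov ne unfolding covered_def by blast+
  note bounds = this entering_submodular[OF A, of X Y] sum le X(2) Y(2)
  show "tight C A (X \<inter> Y)" using bounds unfolding tight_def by linarith
  have "card (colours C (X \<inter> Y)) = card (colours C X \<inter> colours C Y)"
    using bounds unfolding tight_def by linarith
  then show "colours C (X \<inter> Y) = colours C X \<inter> colours C Y"
    using card_subset_eq[OF fin sub] by simp
qed

text \<open>
  Using \<open>a\<close> to give its head the colour \<open>i\<close> can only hurt a tight set that \<open>a\<close> enters and that
  already has the colour \<open>i\<close>. Call a tight set bad if it contains a deficient vertex that lacks one of its
  colours. In a minimal bad set \<open>X\<close>, consider the vertices without some colour \<open>i\<close> of \<open>X\<close> that is
  missing at a deficient vertex. They have fewer colours, hence larger in-degree than \<open>X\<close>, so a hyperarc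
  enters them that has all its tails in \<open>X\<close> and one of them with colour \<open>i\<close>. A tight set hurt by
  this hyperarc would meet \<open>X\<close> in a smaller bad set. If there is no bad set, then a tight set containing a
  deficient vertex never has more colours than that vertex, and it suffices to find any
  hyperarc that brings a new colour to a deficient vertex.
\<close>

lemma extension_exists:
  assumes cov: "covered C A" and A: "finite A" "\<And>a. a \<in> A \<Longrightarrow> hv a \<in> V \<and> ts a \<subseteq> V"
    and deficient: "\<exists>v\<in>V. card (colours C {v}) < h"
  shows "\<exists>a\<in>A. \<exists>i\<in>I. \<exists>u. u \<in> ts a \<and> u \<in> C i \<and> hv a \<notin> C i \<and> card (colours C {hv a}) < h \<and>
    (\<forall>Z\<subseteq>V. tight C A Z \<longrightarrow> a \<in> entering A Z \<longrightarrow> i \<notin> colours C Z)"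
proof -
  have finE: "finite (entering A X)" for X using A by (simp add: entering_def)
  define bad where "bad X \<longleftrightarrow> X \<subseteq> V \<and> tight C A X \<and>
      (\<exists>v\<in>X. card (colours C {v}) < h \<and> colours C {v} \<noteq> colours C X)" for X
  show ?thesis
  proof (cases "\<exists>X. bad X")
    case True
    define X where "X = arg_min card bad"
    have X: "bad X" and minimal: "bad Z \<Longrightarrow> card X \<le> card Z" for Z
      unfolding X_def using True arg_min_natI arg_min_nat_le by metis+
    have XV: "X \<subseteq> V" "tight C A X" using X by (auto simp: bad_def)
    obtain v where v: "v \<in> X" "colours C {v} \<noteq> colours C X" using X unfolding bad_def by blast
    have "colours C {v} \<subseteq> colours C X" using v by (intro colours_mono) simp
    then obtain i where i: "i \<in> colours C X" "i \<notin> colours C {v}" using v(2) by blast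
    have iI: "i \<in> I" using i(1) by (simp add: colours_def)
    define Y where "Y = {w \<in> X. w \<notin> C i}"
    have "Y \<noteq> {}" "Y \<subseteq> V" using v i iI XV by (auto simp: Y_def colours_def)
    then have "h \<le> card (colours C Y) + card (entering A Y)" using cov by (simp add: covered_def)
    moreover have cY: "colours C Y \<subseteq> colours C X - {i}" by (auto simp: Y_def colours_def)
    then have "card (colours C Y) < card (colours C X)"
      using i(1) finite_colours by (metis Diff_subset card_Diff1_less card_mono finite_Diff le_less_trans)
    ultimately have "card (entering A X) < card (entering A Y)"
      using XV(2) unfolding tight_def by linarith
    then obtain a where a: "a \<in> entering A Y" "a \<notin> entering A X"
      using card_mono[OF finE] by (meson leD subsetI)
    have aX: "a \<in> A" "hv a \<in> X" "hv a \<notin> C i" "ts a \<subseteq> X" "\<not> ts a \<subseteq> Y"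
      using a by (auto simp: entering_def Y_def)
    then obtain u where u: "u \<in> ts a" "u \<in> C i" by (auto simp: Y_def)
    have ia: "i \<notin> colours C {hv a}" using aX by (simp add: colours_def)
    have "colours C {hv a} \<subset> colours C X"
      using colours_mono[of "{hv a}" X C] aX(2) i(1) ia by blast
    then have def_a: "card (colours C {hv a}) < h"
      using psubset_card_mono[OF finite_colours] XV(2) unfolding tight_def
      by (meson le_add1 le_trans less_le_trans order_eq_refl)
    have "i \<notin> colours C Z" if Z: "Z \<subseteq> V" "tight C A Z" "a \<in> entering A Z" for Z
    proof
      assume iZ: "i \<in> colours C Z"
      have aZ: "hv a \<in> Z" "\<not> ts a \<subseteq> Z" using Z(3) by (auto simp: entering_def)
      have ne: "X \<inter> Z \<noteq> {}" using aZ aX by blast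
      have "i \<in> colours C (X \<inter> Z)"
        using tight_Int(2)[OF cov A(1) XV Z(1,2) ne] i(1) iZ by simp
      then have "colours C {hv a} \<noteq> colours C (X \<inter> Z)" using ia by blast
      then have "bad (X \<inter> Z)"
        using tight_Int(1)[OF cov A(1) XV Z(1,2) ne] def_a aX aZ XV unfolding bad_def by blast
      then have "card X \<le> card (X \<inter> Z)" by (rule minimal)
      moreover have "X \<inter> Z \<subset> X" using aX aZ by blast
      ultimately show False
        using psubset_card_mono[of X "X \<inter> Z"] XV finite_V finite_subset by fastforce
    qed
    then show ?thesis using aX u iI def_a by blast
  next
    case False
    obtain w where w: "w \<in> V" "card (colours C {w}) < h" using deficient by blast
    \<comment> \<open>The vertices whose colours all occur at \<open>w\<close> have together fewer than \<open>h\<close> colours,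
      so some hyperarc enters them, and a tail outside brings a new colour.\<close>
    define Y where "Y = {x \<in> V. colours C {x} \<subseteq> colours C {w}}"
    have "Y \<noteq> {}" "Y \<subseteq> V" using w by (auto simp: Y_def)
    then have "h \<le> card (colours C Y) + card (entering A Y)" using cov by (simp add: covered_def)
    moreover have "colours C Y \<subseteq> colours C {w}"
    proof
      fix i assume "i \<in> colours C Y"
      then obtain x where "x \<in> Y" "i \<in> colours C {x}" by (auto simp: colours_def)
      then show "i \<in> colours C {w}" by (auto simp: Y_def)
    qed
    then have "card (colours C Y) \<le> card (colours C {w})" by (rule card_mono[OF finite_colours])
    ultimately have "card (entering A Y) > 0" using w by linarith
    then obtain a where a: "a \<in> A" "hv a \<in> Y" "\<not> ts a \<subseteq> Y"
      unfolding card_gt_0_iff entering_def by blast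
    then obtain u where u: "u \<in> ts a" "u \<notin> Y" by blast
    have "u \<in> V" using A(2)[OF a(1)] u by blast
    then obtain i where i: "i \<in> colours C {u}" "i \<notin> colours C {w}" using u by (auto simp: Y_def)
    have sub: "colours C {hv a} \<subseteq> colours C {w}" using a by (simp add: Y_def)
    have ia: "i \<notin> colours C {hv a}" using sub i by blast
    have def_a: "card (colours C {hv a}) < h"
      using card_mono[OF finite_colours sub] w by linarith
    have "i \<notin> colours C Z" if Z: "Z \<subseteq> V" "tight C A Z" "a \<in> entering A Z" for Z
    proof -
      have "hv a \<in> Z" using Z(3) by (simp add: entering_def)
      then have "colours C {hv a} = colours C Z"
        using False Z def_a unfolding bad_def by blast
      then show ?thesis using ia by simp
    qed
    moreover have "i \<in> I" "u \<in> C i" "hv a \<notin> C i" using i ia by (auto simp: colours_def)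
    ultimately show ?thesis using a(1) u(1) def_a by blast
  qed
qed

text \<open>
  Each extension uses up one hyperarc and preserves the covering condition. The bound on the number of
  colours at a vertex is preserved as well, since only deficient vertices get a new colour. When no vertex
  is deficient, every vertex has exactly \<open>h\<close> colours.
\<close>

lemma regular_packing_exists:
  assumes "covered C A" and "finite A" and "\<And>a. a \<in> A \<Longrightarrow> hv a \<in> V \<and> ts a \<subseteq> V"
    and "\<And>i. i \<in> I \<Longrightarrow> C i \<subseteq> V" and "\<And>v. v \<in> V \<Longrightarrow> card (colours C {v}) \<le> h"
  shows "\<exists>F D. (\<forall>i\<in>I. grown hv ts (C i) (F i) (D i) \<and> F i \<subseteq> A \<and> D i \<subseteq> V) \<and>
    (\<forall>i\<in>I. \<forall>j\<in>I. i \<noteq> j \<longrightarrow> F i \<inter> F j = {}) \<and> (\<forall>v\<in>V. card {i \<in> I. v \<in> D i} = h)"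
  using assms
proof (induction "card A" arbitrary: A C)
  case 0
  then have A: "A = {}" by simp
  have "card {i \<in> I. v \<in> C i} = h" if "v \<in> V" for v
  proof -
    have "{v} \<subseteq> V" using that by simp
    then have "h \<le> card (colours C {v}) + card (entering A {v})"
      using 0(2) unfolding covered_def by blast
    then have "card (colours C {v}) = h" using 0(6)[OF that] A by (simp add: entering_def)
    then show ?thesis by (simp add: colours_def)
  qed
  then show ?case using 0(5) by (intro exI[of _ "\<lambda>_. {}"] exI[of _ C]) (simp add: grown_refl)
next
  case (Suc n)
  show ?case
  proof (cases "\<exists>v\<in>V. card (colours C {v}) < h")
    case False
    then have "card (colours C {v}) = h" if "v \<in> V" for v
      using that Suc.prems(5)[OF that] by (meson le_antisym not_le)
    then have "card {i \<in> I. v \<in> C i} = h" if "v \<in> V" for v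
      using that by (simp add: colours_def)
    then show ?thesis
      using Suc.prems(4) by (intro exI[of _ "\<lambda>_. {}"] exI[of _ C]) (simp add: grown_refl)
  next
    case True
    from extension_exists[OF Suc.prems(1-3) True]
    obtain a i u where a: "a \<in> A" "i \<in> I" "u \<in> ts a" "u \<in> C i" "hv a \<notin> C i"
      and def_a: "card (colours C {hv a}) < h"
      and safe: "\<And>Z. Z \<subseteq> V \<Longrightarrow> tight C A Z \<Longrightarrow> a \<in> entering A Z \<Longrightarrow> i \<notin> colours C Z"
      by blast
    define C' where "C' = C(i := insert (hv a) (C i))"
    have finE: "finite (entering B X)" if "finite B" for B X using that by (simp add: entering_def)
    have col: "colours C' X = (if hv a \<in> X then insert i (colours C X) else colours C X)" for X
      using a(2) by (auto simp: colours_def C'_def)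
    have ent: "entering (A - {a}) X = entering A X - {a}" for X by (auto simp: entering_def)
    have cov': "covered C' (A - {a})"
      unfolding covered_def
    proof (intro allI impI)
      fix X assume X: "X \<subseteq> V" "X \<noteq> {}"
      have hX: "h \<le> card (colours C X) + card (entering A X)"
        using Suc.prems(1) X by (simp add: covered_def)
      have mono: "card (colours C X) \<le> card (colours C' X)"
        using finite_colours by (intro card_mono) (auto simp: col)
      show "h \<le> card (colours C' X) + card (entering (A - {a}) X)"
      proof (cases "a \<in> entering A X")
        case False
        then show ?thesis using hX mono by (simp add: ent)
      next
        case aX: True
        then have e: "card (entering A X) = Suc (card (entering (A - {a}) X))"
          unfolding ent using card_Suc_Diff1[OF finE[OF Suc.prems(2)] aX] by simp
        show ?thesis
        proof (cases "tight C A X")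
          case True
          then have "i \<notin> colours C X" using safe X aX by blast
          moreover have "hv a \<in> X" using aX by (simp add: entering_def)
          ultimately have "card (colours C' X) = Suc (card (colours C X))"
            using finite_colours by (simp add: col)
          then show ?thesis using hX e by linarith
        next
          case False
          then show ?thesis using hX e mono unfolding tight_def by linarith
        qed
      qed
    qed
    have deg': "card (colours C' {v}) \<le> h" if "v \<in> V" for v
    proof (cases "v = hv a")
      case True
      then have "card (colours C' {v}) \<le> Suc (card (colours C {hv a}))"
        using card_insert_le_m1[of "Suc (card (colours C {hv a}))"] by (simp add: col card_insert_if finite_colours)
      then show ?thesis using def_a by linarith
    next
      case False
      then show ?thesis using Suc.prems(5)[OF that] by (simp add: col)
    qed
    have sub': "C' j \<subseteq> V" if "j \<in> I" for j
      using Suc.prems(3)[OF a(1)] Suc.prems(4)[OF that] by (auto simp: C'_def)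
    have "n = card (A - {a})" using Suc.hyps(2) a(1) Suc.prems(2) by simp
    moreover have "finite (A - {a})" using Suc.prems(2) by simp
    moreover have "hv b \<in> V \<and> ts b \<subseteq> V" if "b \<in> A - {a}" for b
      using that Suc.prems(3) by simp
    ultimately have "\<exists>F D. (\<forall>j\<in>I. grown hv ts (C' j) (F j) (D j) \<and> F j \<subseteq> A - {a} \<and> D j \<subseteq> V) \<and>
        (\<forall>j\<in>I. \<forall>j'\<in>I. j \<noteq> j' \<longrightarrow> F j \<inter> F j' = {}) \<and> (\<forall>v\<in>V. card {j \<in> I. v \<in> D j} = h)"
      using cov' sub' deg' by (intro Suc.hyps(1)) assumption+
    then obtain F D
      where FD_all: "\<forall>j\<in>I. grown hv ts (C' j) (F j) (D j) \<and> F j \<subseteq> A - {a} \<and> D j \<subseteq> V"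
        and disj: "\<forall>j\<in>I. \<forall>j'\<in>I. j \<noteq> j' \<longrightarrow> F j \<inter> F j' = {}"
        and reg: "\<forall>v\<in>V. card {j \<in> I. v \<in> D j} = h"
      by (elim exE conjE) (rule that; assumption)
    have FD: "grown hv ts (C' j) (F j) (D j)" "F j \<subseteq> A - {a}" "D j \<subseteq> V" if "j \<in> I" for j
      using FD_all that by blast+
    define F' where "F' = F(i := insert a (F i))"
    have "grown hv ts (C j) (F' j) (D j) \<and> F' j \<subseteq> A \<and> D j \<subseteq> V" if j: "j \<in> I" for j
    proof (cases "j = i")
      case True
      have "grown hv ts (insert (hv a) (C i)) (F i) (D i)" "a \<notin> F i"
        using FD[OF a(2)] by (auto simp: C'_def)
      from grown_step[OF this(1) a(5) this(2) a(3,4)] show ?thesis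
        using FD[OF a(2)] a(1) True by (auto simp: F'_def)
    next
      case False
      then show ?thesis using FD[OF j] by (auto simp: F'_def C'_def)
    qed
    moreover have "F' j \<inter> F' j' = {}" if "j \<in> I" "j' \<in> I" "j \<noteq> j'" for j j'
    proof -
      have "F j \<inter> F j' = {}" using disj that by simp
      then show ?thesis using FD(2)[OF that(1)] FD(2)[OF that(2)] that(3) by (auto simp: F'_def)
    qed
    ultimately show ?thesis using reg by (intro exI[of _ F'] exI[of _ D]) simp
  qed
qed

end

section \<open>Hyperbranchings\<close>

context wf_digraph begin

lemma awalk_snoc_iff:
  "awalk u (p @ [a]) v \<longleftrightarrow> awalk u p (tail G a) \<and> a \<in> arcs G \<and> head G a = v"
  by (auto simp: awalk_Cons_iff awalk_Nil_iff awlast_of_awalk dest: awalk_last_in_verts)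

lemma awalk_enters:
  assumes "awalk u p v" "u \<notin> X" "v \<in> X"
  shows "\<exists>a\<in>arcs G. head G a \<in> X \<and> tail G a \<notin> X"
  using assms
proof (induction p arbitrary: u)
  case Nil
  then show ?case by (simp add: awalk_Nil_iff)
next
  case (Cons a p)
  then show ?case by (cases "head G a \<in> X") (auto simp: awalk_Cons_iff)
qed

text \<open>
  A rank that increases along arcs excludes circuits and makes every walk a path. Every vertex outside
  \<open>S\<close> has exactly one entering arc and the vertices of \<open>S\<close> have none, so following the entering arcs
  backwards yields the unique path from \<open>S\<close>.
\<close>

lemma is_branching_of_rank:
  fixes rk :: "'a \<Rightarrow> nat"
  assumes S: "S \<subseteq> verts G" and inj: "inj_on (head G) (arcs G)"
    and heads: "head G ` arcs G = verts G - S"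
    and rk: "\<And>a. a \<in> arcs G \<Longrightarrow> rk (tail G a) < rk (head G a)"
  shows "is_branching G S"
proof -
  have rank_walk: "rk u + length p \<le> rk v" if "awalk u p v" for u p v
    using that
  proof (induction p arbitrary: u)
    case Nil
    then show ?case by (simp add: awalk_Nil_iff)
  next
    case (Cons a p)
    then have "rk (head G a) + length p \<le> rk v" "a \<in> arcs G" "u = tail G a"
      by (auto simp: awalk_Cons_iff)
    then show ?case using rk[of a] by simp
  qed
  have path: "apath u p v" if "awalk u p v" for u p v
    using that
  proof (induction p arbitrary: u)
    case Nil
    then show ?case by (auto simp: awalk_Nil_iff apath_Nil_iff)
  next
    case (Cons a p)
    then have a: "a \<in> arcs G" "u = tail G a" "awalk (head G a) p v" by (auto simp: awalk_Cons_iff)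
    have "tail G a \<notin> set (awalk_verts (head G a) p)"
    proof
      assume "tail G a \<in> set (awalk_verts (head G a) p)"
      then obtain q where "awalk (head G a) q (tail G a)" using awalk_decomp[OF a(3)] by blast
      then show False using rank_walk[of "head G a" q "tail G a"] rk[OF a(1)] by linarith
    qed
    then show ?case using Cons.IH[OF a(3)] a by (simp add: apath_Cons_iff)
  qed
  have reach: "\<exists>s\<in>S. \<exists>p. awalk s p v" if "v \<in> verts G" for v
    using that
  proof (induction "rk v" arbitrary: v rule: less_induct)
    case less
    show ?case
    proof (cases "v \<in> S")
      case True
      then have "awalk v [] v" using less.prems by (simp add: awalk_Nil_iff)
      then show ?thesis using True by blast
    next
      case False
      then obtain a where a: "a \<in> arcs G" "head G a = v" using heads less.prems by (metis DiffI imageE)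
      then obtain s p where "s \<in> S" "awalk s p (tail G a)"
        using less.hyps[of "tail G a"] rk[OF a(1)] by auto
      then have "awalk s (p @ [a]) v" using a by (simp only: awalk_snoc_iff)
      then show ?thesis using \<open>s \<in> S\<close> by blast
    qed
  qed
  have no_head: "head G a \<notin> S" if "a \<in> arcs G" for a using heads that by blast
  have unique: "s = s' \<and> p = p'" if "awalk s p v" "awalk s' p' v" "s \<in> S" "s' \<in> S" for s s' p p' v
    using that
  proof (induction p arbitrary: v p' rule: rev_induct)
    case Nil
    then have v: "v = s" by (simp add: awalk_Nil_iff)
    show ?case
    proof (cases p' rule: rev_cases)
      case Nil
      then show ?thesis using \<open>awalk s' p' v\<close> v by (simp add: awalk_Nil_iff)
    next
      case (snoc q a)
      then have "a \<in> arcs G" "head G a = s"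
        using \<open>awalk s' p' v\<close> v by (simp_all only: awalk_snoc_iff)
      then show ?thesis using no_head \<open>s \<in> S\<close> by blast
    qed
  next
    case (snoc a q)
    then have a: "awalk s q (tail G a)" "a \<in> arcs G" "head G a = v" by (simp_all only: awalk_snoc_iff)
    show ?case
    proof (cases p' rule: rev_cases)
      case Nil
      then have "v = s'" using snoc.prems(2) by (simp add: awalk_Nil_iff)
      then show ?thesis using no_head a snoc.prems(4) by blast
    next
      case p': (snoc q' a')
      then have a': "awalk s' q' (tail G a')" "a' \<in> arcs G" "head G a' = v"
        using snoc.prems(2) by (simp_all only: awalk_snoc_iff)
      then have "a = a'" using inj a by (metis inj_onD)
      then show ?thesis using snoc.IH[OF a(1) _ snoc.prems(3,4)] a' p' by blast
    qed
  qed
  have "\<exists>!(s, p). s \<in> S \<and> apath s p v" if v: "v \<in> verts G" for v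
  proof -
    obtain s p where "s \<in> S" "awalk s p v" using reach[OF v] by blast
    then show ?thesis
      using path unique by (intro ex1I[of _ "(s, p)"]) (auto dest: awalkI_apath)
  qed
  moreover have "\<nexists>p. cycle p"
  proof
    assume "\<exists>p. cycle p"
    then obtain u p where "awalk u p u" "p \<noteq> []" by (auto simp: cycle_def)
    then show False using rank_walk[of u p u] by simp
  qed
  ultimately show ?thesis
    unfolding is_branching_def using S wf_digraph_axioms by blast
qed

end

lemma core_eq_heads_Un_roots:
  assumes "is_dypergraph B"
  shows "core B S = dhead B ` harcs B \<union> S"
proof -
  have "1 \<le> hin_degree B v \<longleftrightarrow> v \<in> dhead B ` harcs B" for v
    using assms card_gt_0_iff[of "{a \<in> harcs B. dhead B a = v}"]
    by (auto simp: hin_degree_def is_dypergraph_def Suc_le_eq)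
  then show ?thesis using assms by (auto simp: core_def is_dypergraph_def)
qed

text \<open>
  Hyperedges have at least two vertices, so a tail is left when the head is removed.
\<close>

lemma orient_is_dypergraph:
  assumes G: "is_hypergraph G" and r: "is_orientation G r"
  shows "is_dypergraph (orient G r)"
proof -
  have "hends G e - {r e} \<noteq> {}" if "e \<in> hedges G" for e
  proof
    assume "hends G e - {r e} = {}"
    then have "card (hends G e) \<le> card {r e}" by (intro card_mono) auto
    moreover have "2 \<le> card (hends G e)" using G that by (simp add: is_hypergraph_def)
    ultimately show False by simp
  qed
  moreover have "hends G e \<subseteq> hverts G" if "e \<in> hedges G" for e
    using G that by (simp add: is_hypergraph_def)
  ultimately show ?thesis
    using G r unfolding is_dypergraph_def is_orientation_def orient_def is_hypergraph_def by auto
qed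

lemma grown_hyperbranching:
  assumes B: "is_dypergraph B" and g: "grown (dhead B) (dtails B) S (harcs B) D" and D: "D \<subseteq> dverts B"
  shows "is_hyperbranching B S" "core B S = D"
proof -
  obtain t rk where t: "\<forall>a\<in>harcs B. t a \<in> dtails B a \<inter> D \<and> (rk (t a) :: nat) < rk (dhead B a)"
    and S: "S \<subseteq> D" "inj_on (dhead B) (harcs B)" "dhead B ` harcs B = D - S"
    using g unfolding grown_def by blast
  show core: "core B S = D" using core_eq_heads_Un_roots[OF B] S by auto
  let ?D = "\<lparr>verts = D, arcs = harcs B, tail = t, head = dhead B\<rparr>"
  interpret wf_digraph ?D using t S by unfold_locales auto
  have "is_branching ?D S"
    using S t by (intro is_branching_of_rank[of _ rk]) auto
  moreover have "is_trimming B t" using t by (simp add: is_trimming_def)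
  ultimately show "is_hyperbranching B S"
    unfolding is_hyperbranching_def core using B S D by blast
qed

text \<open>
  The path from \<open>S\<close> to \<open>v\<close> has to enter \<open>X\<close>, and it does so along a trimmed hyperarc.
\<close>

lemma hyperbranching_enters:
  assumes B: "is_hyperbranching B S" and v: "v \<in> core B S" "v \<in> X" and X: "X \<inter> S = {}"
  shows "\<exists>a\<in>harcs B. dhead B a \<in> X \<and> \<not> dtails B a \<subseteq> X"
proof -
  obtain t where t: "is_trimming B t"
    and br: "is_branching \<lparr>verts = core B S, arcs = harcs B, tail = t, head = dhead B\<rparr> S"
      (is "is_branching ?D S")
    using B unfolding is_hyperbranching_def by blast
  interpret wf_digraph ?D using br by (simp add: is_branching_def)
  have "\<exists>!(s, p). s \<in> S \<and> apath s p v" using br v by (simp add: is_branching_def)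
  then obtain s p where "s \<in> S" "awalk s p v" by (auto simp: apath_def)
  then have "\<exists>a\<in>arcs ?D. head ?D a \<in> X \<and> tail ?D a \<notin> X"
    using v X by (intro awalk_enters[of s p v]) auto
  then show ?thesis using t by (auto simp: is_trimming_def)
qed

section \<open>Necessity\<close>

text \<open>
  A hyperedge is counted at the member containing its head only, and it belongs to at most one of the
  hyperforests. So all members together are entered by at most \<open>entering_hyperedges G P\<close> of them.
\<close>

lemma packing_partition_bound:
  assumes G: "is_hypergraph G" and packing: "hyperforest_packing G k T S"
    and regular: "regular_packing G h k T S" and P: "partition_on (hverts G) P"
  shows "h * card P \<le> (\<Sum>i=1..k. min (card (S i)) (card P)) + entering_hyperedges G P"
proof -
  obtain r where r: "\<And>i. i \<in> {1..k} \<Longrightarrow> is_orientation (T i) (r i)"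
      "\<And>i. i \<in> {1..k} \<Longrightarrow> is_hyperbranching (orient (T i) (r i)) (S i)"
    and reg: "\<And>v. v \<in> hverts G \<Longrightarrow> card {i \<in> {1..k}. v \<in> core (orient (T i) (r i)) (S i)} = h"
    using regular unfolding regular_packing_def by blast
  have T: "subhypergraph (T i) G" if "i \<in> {1..k}" for i
    using packing that by (simp add: hyperforest_packing_def)
  have disj: "hedges (T i) \<inter> hedges (T j) = {}" if "i \<in> {1..k}" "j \<in> {1..k}" "i \<noteq> j" for i j
    using packing that by (simp add: hyperforest_packing_def)
  have finV: "finite (hverts G)" and finE: "finite (hedges G)"
    using G by (simp_all add: is_hypergraph_def)
  have finP: "finite P" using finite_elements[OF finV P] .
  have finS: "finite (S i)" if "i \<in> {1..k}" for i
  proof -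
    have "S i \<subseteq> hverts (T i)" using r(2)[OF that] by (simp add: is_hyperbranching_def orient_def)
    also have "\<dots> \<subseteq> hverts G" using T[OF that] by (simp add: subhypergraph_def)
    finally show ?thesis using finV by (rule finite_subset)
  qed
  define E where "E = {e \<in> hedges G. 2 \<le> card {X \<in> P. hends G e \<inter> X \<noteq> {}}}"
  \<comment> \<open>Hyperedges are paired with the index of their hyperforest because each index has its
    own choice \<open>r i\<close> of heads.\<close>
  define Q where "Q = {(i, e). i \<in> {1..k} \<and> e \<in> hedges (T i) \<and> e \<in> E}"
  define M where "M X = {(i, e) \<in> Q. r i e \<in> X}" for X
  have Qsub: "Q \<subseteq> {1..k} \<times> E" by (auto simp: Q_def)
  have finQ: "finite Q" using finE by (intro finite_subset[OF Qsub]) (simp add: E_def)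
  have MQ: "M X \<subseteq> Q" for X by (auto simp: M_def)
  have finM: "finite (M X)" for X using finite_subset[OF MQ finQ] .
  have "inj_on snd Q" using disj by (force simp: Q_def inj_on_def)
  then have cardQ: "card Q \<le> entering_hyperedges G P"
    unfolding entering_hyperedges_def E_def[symmetric] using finE
    by (intro card_inj_on_le[of snd]) (auto simp: Q_def E_def)
  have bound: "h \<le> card {i \<in> {1..k}. S i \<inter> X \<noteq> {}} + card (M X)" if X: "X \<in> P" for X
  proof -
    have "X \<noteq> {}" using partition_onD3[OF P] X by blast
    then obtain v where v: "v \<in> X" "v \<in> hverts G" using partition_onD1[OF P] X by blast
    have "{i \<in> {1..k}. v \<in> core (orient (T i) (r i)) (S i)} \<subseteq> {i \<in> {1..k}. S i \<inter> X \<noteq> {}} \<union> fst ` M X"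
    proof
      fix i assume "i \<in> {i \<in> {1..k}. v \<in> core (orient (T i) (r i)) (S i)}"
      then have i: "i \<in> {1..k}" "v \<in> core (orient (T i) (r i)) (S i)" by auto
      show "i \<in> {i \<in> {1..k}. S i \<inter> X \<noteq> {}} \<union> fst ` M X"
      proof (cases "X \<inter> S i = {}")
        case False
        then show ?thesis using i by blast
      next
        case True
        obtain e where e: "e \<in> hedges (T i)" "r i e \<in> X" "\<not> hends (T i) e - {r i e} \<subseteq> X"
          using hyperbranching_enters[OF r(2)[OF i(1)] i(2) v(1) True] by (auto simp: orient_def)
        have eG: "e \<in> hedges G" "hends (T i) e = hends G e"
          using T[OF i(1)] e(1) by (auto simp: subhypergraph_def)
        have re: "r i e \<in> hends G e" using r(1)[OF i(1)] e(1) eG by (auto simp: is_orientation_def)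
        have "\<not> (\<exists>Y\<in>P. hends G e \<subseteq> Y)"
        proof
          assume "\<exists>Y\<in>P. hends G e \<subseteq> Y"
          then obtain Y where Y: "Y \<in> P" "hends G e \<subseteq> Y" by blast
          then have "X \<inter> Y \<noteq> {}" using re e(2) by blast
          then have "X = Y" using partition_onD2[OF P] X Y(1) by (auto simp: disjoint_def)
          then show False using Y e(3) eG by blast
        qed
        moreover have "hends G e \<subseteq> hverts G" using G eG by (simp add: is_hypergraph_def)
        moreover have "hends G e \<noteq> {}" using re by blast
        ultimately have "e \<in> E"
          using hyperedge_within_iff[OF P finV] eG by (simp add: E_def)
        then have "(i, e) \<in> M X" using e i by (simp add: M_def Q_def)
        then show ?thesis by force
      qed
    qed
    then have "h \<le> card ({i \<in> {1..k}. S i \<inter> X \<noteq> {}} \<union> fst ` M X)"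
      unfolding reg[OF v(2), symmetric] using finM by (intro card_mono) auto
    also have "\<dots> \<le> card {i \<in> {1..k}. S i \<inter> X \<noteq> {}} + card (fst ` M X)" by (rule card_Un_le)
    also have "card (fst ` M X) \<le> card (M X)" by (rule card_image_le[OF finM])
    finally show ?thesis by simp
  qed
  have "h * card P \<le> (\<Sum>X\<in>P. card {i \<in> {1..k}. S i \<inter> X \<noteq> {}} + card (M X))"
    using sum_mono[of P "\<lambda>_. h", OF bound] by (simp add: mult.commute)
  also have "\<dots> = (\<Sum>X\<in>P. card {i \<in> {1..k}. S i \<inter> X \<noteq> {}}) + (\<Sum>X\<in>P. card (M X))"
    by (rule sum.distrib)
  also have "(\<Sum>X\<in>P. card {i \<in> {1..k}. S i \<inter> X \<noteq> {}}) = (\<Sum>i=1..k. card {X \<in> P. S i \<inter> X \<noteq> {}})"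
    using finP by (intro sum_multicount_gen) auto
  also have "\<dots> \<le> (\<Sum>i=1..k. min (card (S i)) (card P))"
    using finS by (intro sum_mono card_members_meeting_le[OF P finV]) auto
  also have "(\<Sum>X\<in>P. card (M X)) = card (\<Union>X\<in>P. M X)"
    using finP finM partition_onD2[OF P]
    by (intro card_UN_disjoint[symmetric]) (auto simp: M_def disjoint_def)
  also have "\<dots> \<le> card Q" using finQ MQ by (intro card_mono) auto
  also note cardQ
  finally show ?thesis by simp
qed

text \<open>
  Roots belong to their cores, and every vertex lies in only \<open>h\<close> cores.
\<close>

lemma packing_root_count_le:
  assumes G: "is_hypergraph G" and packing: "hyperforest_packing G k T S"
    and regular: "regular_packing G h k T S"
  shows "(\<Sum>i=1..k. card (S i)) \<le> h * card (hverts G)"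
proof -
  obtain r where hb: "\<And>i. i \<in> {1..k} \<Longrightarrow> is_hyperbranching (orient (T i) (r i)) (S i)"
    and reg: "\<And>v. v \<in> hverts G \<Longrightarrow> card {i \<in> {1..k}. v \<in> core (orient (T i) (r i)) (S i)} = h"
    using regular unfolding regular_packing_def by blast
  have finV: "finite (hverts G)" using G by (simp add: is_hypergraph_def)
  have SV: "S i \<subseteq> hverts G" if "i \<in> {1..k}" for i
  proof -
    have "S i \<subseteq> hverts (T i)" using hb[OF that] by (simp add: is_hyperbranching_def orient_def)
    also have "\<dots> \<subseteq> hverts G"
      using packing that by (simp add: hyperforest_packing_def subhypergraph_def)
    finally show ?thesis .
  qed
  have "(\<Sum>i=1..k. card (S i)) = (\<Sum>i=1..k. card {v \<in> hverts G. v \<in> S i})"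
  proof (rule sum.cong[OF refl])
    fix i assume "i \<in> {1..k}"
    then have "S i = {v \<in> hverts G. v \<in> S i}" using SV by blast
    then show "card (S i) = card {v \<in> hverts G. v \<in> S i}" by (rule arg_cong)
  qed
  also have "\<dots> = (\<Sum>v\<in>hverts G. card {i \<in> {1..k}. v \<in> S i})"
    using finV by (intro sum_multicount_gen) auto
  also have "\<dots> \<le> (\<Sum>v\<in>hverts G. h)"
  proof (rule sum_mono)
    fix v assume v: "v \<in> hverts G"
    have "card {i \<in> {1..k}. v \<in> S i} \<le> card {i \<in> {1..k}. v \<in> core (orient (T i) (r i)) (S i)}"
      by (intro card_mono) (auto simp: core_def)
    then show "card {i \<in> {1..k}. v \<in> S i} \<le> h" using reg[OF v] by simp
  qed
  finally show ?thesis by (simp add: mult.commute)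
qed

section \<open>Sizes of the root sets\<close>

lemma sum_intermediate_value:
  fixes a b :: "'i \<Rightarrow> nat"
  assumes "finite I" and ab: "\<And>i. i \<in> I \<Longrightarrow> a i \<le> b i" and "sum a I \<le> M" and "M \<le> sum b I"
  shows "\<exists>m. (\<forall>i\<in>I. a i \<le> m i \<and> m i \<le> b i) \<and> sum m I = M"
  using assms(3,4)
proof (induction M rule: dec_induct)
  case base
  then show ?case using ab by blast
next
  case (step M)
  then obtain m where m: "\<forall>i\<in>I. a i \<le> m i \<and> m i \<le> b i" "sum m I = M" by auto
  have "\<exists>i\<in>I. m i < b i"
  proof (rule ccontr)
    assume "\<not> ?thesis"
    then have "sum b I \<le> sum m I" by (intro sum_mono) (meson not_le)
    then show False using m step by simp
  qed
  then obtain i where i: "i \<in> I" "m i < b i" by blast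
  have "sum (m(i := Suc (m i))) I = Suc M"
    using i(1) m(2) \<open>finite I\<close> by (simp add: sum.remove[of I i])
  moreover have "\<forall>j\<in>I. a j \<le> (m(i := Suc (m i))) j \<and> (m(i := Suc (m i))) j \<le> b j"
    using m(1) i by (auto simp: le_Suc_eq)
  ultimately show ?case by blast
qed

text \<open>
  Clamp a common level \<open>c\<close> to the intervals \<open>[l i, l' i]\<close>. As \<open>c\<close> grows, the sum of the clamped levels grows
  from \<open>sum l I\<close> to \<open>sum l' I\<close>, so \<open>M\<close> lies between the sums for two consecutive levels \<open>c\<close> and \<open>c + 1\<close>,
  and \<open>m\<close> is chosen between the two. For \<open>p \<le> c\<close> only the upper bounds \<open>l'\<close> restrict
  \<open>min (m i) p\<close>. For \<open>p > c\<close> a value \<open>m i > p\<close> occurs only if \<open>m i = l i\<close>, so clipping at \<open>p\<close>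
  loses no more from \<open>m\<close> than from \<open>l\<close>.
\<close>

lemma balanced_sizes_exist:
  fixes l l' :: "'i \<Rightarrow> nat"
  assumes fin: "finite I" and ll': "\<And>i. i \<in> I \<Longrightarrow> l i \<le> l' i" and lo: "sum l I \<le> M" and hi: "M \<le> sum l' I"
  shows "\<exists>m. (\<forall>i\<in>I. l i \<le> m i \<and> m i \<le> l' i) \<and> sum m I = M \<and>
    (\<forall>p. (\<Sum>i\<in>I. min (l' i) p) \<le> (\<Sum>i\<in>I. min (m i) p) \<or>
         M + (\<Sum>i\<in>I. min (l i) p) \<le> (\<Sum>i\<in>I. min (m i) p) + sum l I)"
proof -
  define clamp where "clamp c i = min (l' i) (max c (l i))" for c i
  have "clamp (Suc (sum l' I)) i = l' i" if "i \<in> I" for i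
  proof -
    have "l' i \<le> sum l' I" using that fin by (simp add: member_le_sum)
    then show ?thesis by (simp add: clamp_def)
  qed
  then have ex: "M \<le> sum (clamp (Suc (sum l' I))) I" using hi by simp
  define c where "c = (LEAST c. M \<le> sum (clamp (Suc c)) I)"
  have above: "M \<le> sum (clamp (Suc c)) I" unfolding c_def by (rule LeastI[of _ "sum l' I"]) (rule ex)
  have below: "sum (clamp c) I \<le> M"
  proof (cases c)
    case 0
    have "sum (clamp 0) I = sum l I" using ll' by (intro sum.cong) (auto simp: clamp_def)
    then show ?thesis using lo 0 by simp
  next
    case (Suc d)
    then have "\<not> M \<le> sum (clamp (Suc d)) I"
      using not_less_Least[of d "\<lambda>c. M \<le> sum (clamp (Suc c)) I"] unfolding c_def by simp
    then show ?thesis using Suc by simp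
  qed
  have "clamp c i \<le> clamp (Suc c) i" for i by (auto simp: clamp_def)
  then obtain m where m: "\<forall>i\<in>I. clamp c i \<le> m i \<and> m i \<le> clamp (Suc c) i" "sum m I = M"
    using sum_intermediate_value[OF fin _ below above] by blast
  have bounds: "l i \<le> m i \<and> m i \<le> l' i" if "i \<in> I" for i
    using m(1) that ll'[OF that] by (force simp: clamp_def)
  have "(\<Sum>i\<in>I. min (l' i) p) \<le> (\<Sum>i\<in>I. min (m i) p) \<or>
      M + (\<Sum>i\<in>I. min (l i) p) \<le> (\<Sum>i\<in>I. min (m i) p) + sum l I" for p
  proof (cases "p \<le> c")
    case True
    have "min (l' i) p \<le> min (m i) p" if "i \<in> I" for i
    proof -
      have "clamp c i \<le> m i" using m(1) that by blast
      then show ?thesis using True unfolding clamp_def by linarith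
    qed
    then show ?thesis by (intro disjI1 sum_mono)
  next
    case False
    have "m i + min (l i) p \<le> min (m i) p + l i" if "i \<in> I" for i
    proof -
      have "m i \<le> clamp (Suc c) i" using m(1) that by blast
      then show ?thesis using False bounds[OF that] unfolding clamp_def by linarith
    qed
    then have "(\<Sum>i\<in>I. m i + min (l i) p) \<le> (\<Sum>i\<in>I. min (m i) p + l i)" by (rule sum_mono)
    then show ?thesis using m(2) by (simp add: sum.distrib)
  qed
  then show ?thesis using bounds m(2) by blast
qed

text \<open>
  This is needed when \<open>M = h * card V\<close> is smaller than \<open>\<beta>\<close>: the condition that involves \<open>\<beta>\<close> then holds with
  \<open>h * card V\<close> in its place. At most \<open>h\<close> clipped terms lose at most \<open>n - p\<close> each, while more than \<open>h\<close> of
  them keep at least \<open>h * p\<close> of the total.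
\<close>

lemma clipping_loss_bound:
  fixes l :: "'i \<Rightarrow> nat"
  assumes fin: "finite I" and l: "\<And>i. i \<in> I \<Longrightarrow> l i \<le> n" and total: "sum l I \<le> h * n" and p: "p \<le> n"
  shows "sum l I + h * p \<le> h * n + (\<Sum>i\<in>I. min (l i) p)"
proof -
  define J where "J = {i \<in> I. p < l i}"
  have J: "J \<subseteq> I" by (auto simp: J_def)
  have split: "sum g I = sum g (I - J) + sum g J" for g :: "'i \<Rightarrow> nat"
    using sum.subset_diff[OF J fin] .
  have "(\<Sum>i\<in>I - J. min (l i) p) = sum l (I - J)" by (intro sum.cong) (auto simp: J_def)
  moreover have "(\<Sum>i\<in>J. min (l i) p) = (\<Sum>i\<in>J. p)" by (intro sum.cong) (auto simp: J_def)
  ultimately have mins: "(\<Sum>i\<in>I. min (l i) p) = sum l (I - J) + card J * p" by (simp add: split)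
  have "sum l J + h * p \<le> h * n + card J * p"
  proof (cases "card J \<le> h")
    case True
    then obtain d where d: "h = card J + d" using le_Suc_ex by blast
    have "sum l J \<le> (\<Sum>i\<in>J. n)" using J l by (intro sum_mono) auto
    then have "sum l J \<le> card J * n" by simp
    moreover have "d * p \<le> d * n" using p by simp
    ultimately show ?thesis unfolding d add_mult_distrib by linarith
  next
    case False
    then have "h * p \<le> card J * p" by simp
    moreover have "sum l J \<le> h * n" using total split[of l] by simp
    ultimately show ?thesis by linarith
  qed
  then show ?thesis using mins split[of l] by simp
qed

section \<open>Existence of packings\<close>

text \<open>
  Tokens provide the roots and \<open>covering_orientation_exists\<close> the heads. The hyperforests are spanned by
  the hyperarcs that the extension process assigns to each colour; the same choice of heads serves
  all of them.
\<close>

lemma packing_with_sizes_exists: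
  fixes G :: "('a, 'e) hypergraph"
  assumes G: "is_hypergraph G" and h: "0 < h"
    and m_le: "\<And>i. i \<in> {1..k} \<Longrightarrow> m i \<le> card (hverts G)"
    and m_sum: "(\<Sum>i=1..k. m i) \<le> h * card (hverts G)"
    and cond: "\<And>P. partition_on (hverts G) P \<Longrightarrow>
      h * card P \<le> (\<Sum>i=1..k. min (m i) (card P)) + entering_hyperedges G P"
  shows "\<exists>T S. hyperforest_packing G k T S \<and> regular_packing G h k T S \<and> (\<forall>i\<in>{1..k}. card (S i) = m i)"
proof -
  let ?V = "hverts G" and ?E = "hedges G" and ?ends = "hends G"
  interpret root_tokens ?V ?E ?ends h k
    using G h by unfold_locales (auto simp: is_hypergraph_def)
  obtain S E' where S: "\<forall>i\<in>{1..k}. S i \<subseteq> ?V \<and> card (S i) = m i" and E': "E' \<subseteq> ?E"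
    and total: "card E' + (\<Sum>i=1..k. m i) = h * card ?V"
    and sparse: "\<forall>X\<subseteq>?V. X \<noteq> {} \<longrightarrow> (\<Sum>i=1..k. card (S i \<inter> X)) + card {e \<in> E'. ?ends e \<subseteq> X} + h
      \<le> h * card X + min h (card {i \<in> {1..k}. S i \<inter> X \<noteq> {}})"
    using tight_roots_exist[OF m_le m_sum] cond entering_hyperedges_conv[OF G] by auto
  have "card E' + (\<Sum>i=1..k. card (S i)) = h * card ?V" using total S by simp
  then obtain r where r: "\<forall>e\<in>E'. r e \<in> ?ends e" and deg: "\<forall>v\<in>?V. card {i \<in> {1..k}. v \<in> S i} \<le> h"
    and cover: "\<forall>X\<subseteq>?V. X \<noteq> {} \<longrightarrow> h \<le> card {i \<in> {1..k}. S i \<inter> X \<noteq> {}}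
      + card {e \<in> E'. r e \<in> X \<and> \<not> ?ends e - {r e} \<subseteq> X}"
    using covering_orientation_exists[of S E'] S E' sparse by blast
  let ?tails = "\<lambda>e. ?ends e - {r e}"
  interpret D: coloured_dypergraph ?V "{1..k}" r ?tails h
    using finite_V by unfold_locales auto
  have "D.covered S E'" using cover unfolding D.covered_def D.colours_def D.entering_def .
  moreover have "finite E'" using E' finite_E finite_subset by blast
  moreover have "r e \<in> ?V \<and> ?tails e \<subseteq> ?V" if "e \<in> E'" for e
    using r that E' ends_sub by blast
  moreover have "S i \<subseteq> ?V" if "i \<in> {1..k}" for i using S that by blast
  moreover have "card (D.colours S {v}) \<le> h" if "v \<in> ?V" for v
    using deg that unfolding D.colours_def by simp
  ultimately have "\<exists>F D. (\<forall>i\<in>{1..k}. grown r ?tails (S i) (F i) (D i) \<and> F i \<subseteq> E' \<and> D i \<subseteq> ?V) \<and>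
      (\<forall>i\<in>{1..k}. \<forall>j\<in>{1..k}. i \<noteq> j \<longrightarrow> F i \<inter> F j = {}) \<and> (\<forall>v\<in>?V. card {i \<in> {1..k}. v \<in> D i} = h)"
    by (intro D.regular_packing_exists) assumption+
  then obtain F D where FD: "\<forall>i\<in>{1..k}. grown r ?tails (S i) (F i) (D i) \<and> F i \<subseteq> E' \<and> D i \<subseteq> ?V"
    and disj: "\<forall>i\<in>{1..k}. \<forall>j\<in>{1..k}. i \<noteq> j \<longrightarrow> F i \<inter> F j = {}"
    and reg: "\<forall>v\<in>?V. card {i \<in> {1..k}. v \<in> D i} = h"
    by (elim exE conjE) (rule that; assumption)
  define T where "T i = G\<lparr>hedges := F i\<rparr>" for i
  have T_simps: "hverts (T i) = ?V" "hedges (T i) = F i" "hends (T i) = ?ends" for i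
    by (simp_all add: T_def)
  have FE: "F i \<subseteq> ?E" if "i \<in> {1..k}" for i using FD that E' by blast
  have T: "is_hypergraph (T i)" if i: "i \<in> {1..k}" for i
    using G FE[OF i] finite_subset[OF FE[OF i]] by (auto simp: is_hypergraph_def T_simps)
  have ori: "is_orientation (T i) r" if i: "i \<in> {1..k}" for i
  proof -
    have "F i \<subseteq> E'" using FD i by blast
    then show ?thesis using r by (auto simp: is_orientation_def T_simps)
  qed
  have "grown (dhead (orient (T i) r)) (dtails (orient (T i) r)) (S i) (harcs (orient (T i) r)) (D i)"
      "D i \<subseteq> dverts (orient (T i) r)" if i: "i \<in> {1..k}" for i
    using bspec[OF FD i] by (simp_all add: orient_def T_simps)
  then have hb: "is_hyperbranching (orient (T i) r) (S i)" "core (orient (T i) r) (S i) = D i"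
    if i: "i \<in> {1..k}" for i
    using grown_hyperbranching[OF orient_is_dypergraph[OF T[OF i] ori[OF i]]] i by blast+
  have "subhypergraph (T i) G" if i: "i \<in> {1..k}" for i
    using T[OF i] FE[OF i] by (simp add: subhypergraph_def T_simps)
  moreover have "is_hyperforest (T i) (S i)" if i: "i \<in> {1..k}" for i
    unfolding is_hyperforest_def using T[OF i] ori[OF i] hb(1)[OF i] by blast
  ultimately have "hyperforest_packing G k T S"
    unfolding hyperforest_packing_def T_simps using disj by blast
  moreover have "{i \<in> {1..k}. v \<in> core (orient (T i) r) (S i)} = {i \<in> {1..k}. v \<in> D i}" for v
    using hb(2) by blast
  then have "regular_packing G h k T S"
    unfolding regular_packing_def using ori hb(1) reg by (intro exI[of _ "\<lambda>_. r"]) simp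
  ultimately show ?thesis using S by blast
qed

theorem theorem16:
  fixes G :: "('a, 'e) hypergraph"
    and h k \<alpha> \<beta> :: nat
    and l l' :: "nat \<Rightarrow> nat"
  assumes "is_hypergraph G"
    and "0 < h" and "0 < k" and "0 < \<alpha>" and "0 < \<beta>"
    and "\<And>i. i \<in> {1..k} \<Longrightarrow> 0 < l i" and "\<And>i. i \<in> {1..k} \<Longrightarrow> 0 < l' i"
    and "\<beta> \<le> (\<Sum>i=1..k. l' i)" and "\<alpha> \<le> \<beta>" and "(\<Sum>i=1..k. l i) \<le> \<alpha>"
    and "\<And>i. i \<in> {1..k} \<Longrightarrow> l' i \<le> card (hverts G)"
    and "\<And>i. i \<in> {1..k} \<Longrightarrow> l i \<le> l' i"
  shows "(\<exists>T S. hyperforest_packing G k T S \<and> regular_packing G h k T S \<and>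
            bordered_packing k l l' S \<and> limited_packing k \<alpha> \<beta> S) \<longleftrightarrow>
         (h * card (hverts G) \<ge> \<alpha> \<and>
          (\<forall>P. partition_on (hverts G) P \<longrightarrow>
             int \<beta> - (\<Sum>i=1..k. int (l i)) + (\<Sum>i=1..k. int (min (l i) (card P)))
               + int (entering_hyperedges G P) \<ge> int h * int (card P)) \<and>
          (\<forall>P. partition_on (hverts G) P \<longrightarrow>
             (\<Sum>i=1..k. min (l' i) (card P)) + entering_hyperedges G P \<ge> h * card P))"
    (is "?packing \<longleftrightarrow> ?roots \<and> ?lower \<and> ?upper")
proof -
  note G = assms(1) and ll' = assms(12) and l'V = assms(11)
  have finV: "finite (hverts G)" using G by (simp add: is_hypergraph_def)
  have nat_form: "int \<beta> - (\<Sum>i=1..k. int (l i)) + (\<Sum>i=1..k. int (min (l i) (card P)))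
        + int (entering_hyperedges G P) \<ge> int h * int (card P) \<longleftrightarrow>
      h * card P + (\<Sum>i=1..k. l i) \<le> \<beta> + (\<Sum>i=1..k. min (l i) (card P)) + entering_hyperedges G P"
    (is "?int \<longleftrightarrow> ?a \<le> ?b") for P
  proof -
    have "?int \<longleftrightarrow> int ?a \<le> int ?b" unfolding of_nat_add of_nat_mult of_nat_sum by linarith
    then show ?thesis by (simp only: of_nat_le_iff)
  qed
  show ?thesis
  proof
    assume ?packing
    then obtain T S where packing: "hyperforest_packing G k T S" and regular: "regular_packing G h k T S"
      and border: "\<And>i. i \<in> {1..k} \<Longrightarrow> l i \<le> card (S i) \<and> card (S i) \<le> l' i"
      and limit: "\<alpha> \<le> (\<Sum>i=1..k. card (S i))" "(\<Sum>i=1..k. card (S i)) \<le> \<beta>"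
      unfolding bordered_packing_def limited_packing_def by blast
    note bound = packing_partition_bound[OF G packing regular]
    have ?roots using limit(1) packing_root_count_le[OF G packing regular] by simp
    moreover have ?lower
      unfolding nat_form
    proof (intro allI impI)
      fix P assume P: "partition_on (hverts G) P"
      have "(\<Sum>i=1..k. min (card (S i)) (card P) + l i) \<le> (\<Sum>i=1..k. card (S i) + min (l i) (card P))"
      proof (rule sum_mono)
        fix i assume "i \<in> {1..k}"
        then show "min (card (S i)) (card P) + l i \<le> card (S i) + min (l i) (card P)"
          using border[of i] by linarith
      qed
      then show "h * card P + (\<Sum>i=1..k. l i) \<le> \<beta> + (\<Sum>i=1..k. min (l i) (card P)) + entering_hyperedges G P"
        using bound[OF P] limit(2) unfolding sum.distrib by linarith
    qed
    moreover have ?upper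
    proof (intro allI impI)
      fix P assume P: "partition_on (hverts G) P"
      have "(\<Sum>i=1..k. min (card (S i)) (card P)) \<le> (\<Sum>i=1..k. min (l' i) (card P))"
        using border by (intro sum_mono min.mono) auto
      then show "h * card P \<le> (\<Sum>i=1..k. min (l' i) (card P)) + entering_hyperedges G P"
        using bound[OF P] by linarith
    qed
    ultimately show "?roots \<and> ?lower \<and> ?upper" by blast
  next
    assume conds: "?roots \<and> ?lower \<and> ?upper"
    \<comment> \<open>There is room for \<open>h\<close> roots at every vertex only.\<close>
    define M where "M = min \<beta> (h * card (hverts G))"
    have M: "\<alpha> \<le> M" "M \<le> \<beta>" "M \<le> h * card (hverts G)" using conds assms(9) by (auto simp: M_def)
    have "(\<Sum>i=1..k. l i) \<le> M" "M \<le> (\<Sum>i=1..k. l' i)" using M assms(8,10) by linarith+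
    from balanced_sizes_exist[OF finite_atLeastAtMost ll' this]
    obtain m where m: "\<forall>i\<in>{1..k}. l i \<le> m i \<and> m i \<le> l' i" and m_sum: "(\<Sum>i=1..k. m i) = M"
      and balanced: "\<forall>p. (\<Sum>i=1..k. min (l' i) p) \<le> (\<Sum>i=1..k. min (m i) p) \<or>
        M + (\<Sum>i=1..k. min (l i) p) \<le> (\<Sum>i=1..k. min (m i) p) + (\<Sum>i=1..k. l i)"
      by blast
    have "h * card P \<le> (\<Sum>i=1..k. min (m i) (card P)) + entering_hyperedges G P"
      if P: "partition_on (hverts G) P" for P
    proof -
      have upper: "h * card P \<le> (\<Sum>i=1..k. min (l' i) (card P)) + entering_hyperedges G P"
        using conds P by blast
      have "h * card P + (\<Sum>i=1..k. l i) \<le> \<beta> + (\<Sum>i=1..k. min (l i) (card P)) + entering_hyperedges G P"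
        using conds P nat_form by blast
      moreover have "(\<Sum>i=1..k. l i) + h * card P
          \<le> h * card (hverts G) + (\<Sum>i=1..k. min (l i) (card P))"
      proof (rule clipping_loss_bound)
        show "l i \<le> card (hverts G)" if "i \<in> {1..k}" for i using ll'[OF that] l'V[OF that] by linarith
        show "(\<Sum>i=1..k. l i) \<le> h * card (hverts G)" using assms(10) conds by linarith
        show "card P \<le> card (hverts G)" using card_partition_le[OF P finV] .
      qed simp
      ultimately have lower: "h * card P + (\<Sum>i=1..k. l i)
          \<le> M + (\<Sum>i=1..k. min (l i) (card P)) + entering_hyperedges G P"
        unfolding M_def by linarith
      from balanced[rule_format, of "card P"] upper lower show ?thesis by linarith
    qed
    moreover have "m i \<le> card (hverts G)" if "i \<in> {1..k}" for i
      using m that l'V[OF that] by force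
    moreover have "(\<Sum>i=1..k. m i) \<le> h * card (hverts G)" using m_sum M by simp
    ultimately obtain T S where TS: "hyperforest_packing G k T S" "regular_packing G h k T S"
      and card: "\<forall>i\<in>{1..k}. card (S i) = m i"
      using packing_with_sizes_exists[OF G assms(2)] by blast
    have "(\<Sum>i=1..k. card (S i)) = M" using card m_sum by simp
    then have "bordered_packing k l l' S" "limited_packing k \<alpha> \<beta> S"
      using card m M by (simp_all add: bordered_packing_def limited_packing_def)
    then show ?packing using TS by blast
  qed
qed

end
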